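(* Let $A$, $B$ and $C$ be three non-trivial $SL(2,\mathbb{C})$-modules of dimension $n+1$, $m+1$ and $n+m+1$ respectively, and let $\phi$ be a hyperplane in $\mathbb{P}(A\otimes B\otimes C)$ which is invariant under $SL(2,\mathbb{C})$; view $\phi$ as a nonzero linear map $\phi:A\otimes B\to C^{*}$, defined up to a nonzero scalar. Then $$\mathrm{Det}(\phi)\neq 0\iff \phi\text{ is the multiplication } S_n\otimes S_m\to S_{n+m},$$ where the right-hand side means that there are isomorphisms of $SL(2,\mathbb{C})$-modules $A\cong S_n$, $B\cong S_m$, $C^{*}\cong S_{n+m}$ under which $\phi$ becomes, up to a nonzero scalar, the multiplication map $f\otimes g\mapsto fg$ of binary forms.
   Context: An $SL(2,\mathbb{C})$-module is a finite-dimensional algebraic complex representation of $SL(2,\mathbb{C})$; it is non-trivial if $SL(2,\mathbb{C})$ does not act trivially on it. $S_i$ denotes the irreducible $SL(2,\mathbb{C})$-representation of degree $i$, i.e. the space of homogeneous polynomials of degree $i$ in $x,y$, with basis $(x^{i-k}y^k)_{k=0,\dots,i}$, of dimension $i+1$. $\mathbb{P}(V)$ denotes the projective space of lines in $V$. A hyperplane in $\mathbb{P}(A\otimes B\otimes C)$ is given by a nonzero linear form on $A\otimes B\otimes C$ up to scalar, equivalently by a nonzero linear map $\phi:A\otimes B\to C^{*}$ up to scalar. Here $\dim C=\dim A+\dim B-1$ (boundary format). In this case the variety $(\mathbb{P}(A)\times\mathbb{P}(B)\times\mathbb{P}(C))^{\vee}$ of hyperplanes of $\mathbb{P}(A\otimes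 B\otimes C)$ tangent to the Segre variety $\mathbb{P}(A)\times\mathbb{P}(B)\times\mathbb{P}(C)$ at some point is a hypersurface in the dual projective space, defined by the vanishing of the hyperdeterminant $\mathrm{Det}$. Thus $\mathrm{Det}(\phi)\neq 0$ means that the hyperplane $\phi$ is not tangent to the Segre variety at any point, i.e. there are no nonzero $a\in A$, $b\in B$, $c\in C$ such that $\phi(a'\otimes b)(c)=0$ for all $a'\in A$, $\phi(a\otimes b')(c)=0$ for all $b'\in B$ and $\phi(a\otimes b)(c')=0$ for all $c'\in C$. Equivalently, $\phi(a\otimes b)\neq 0$ for all nonzero $a\in A$ and nonzero $b\in B$. *)

theory Defs
  imports "HOL-Analysis.Analysis" "HOL-Library.Function_Algebras"
begin

section \<open>Modules over the special linear group\<close>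

definition SL2 :: "(complex^2^2) set" where
  "SL2 = {g. det g = 1}"

text \<open>Polynomials in the four matrix entries. The coordinate ring of the group is generated by
  the entries, so its regular functions are exactly the restrictions of these.\<close>

inductive entry_polynomial :: "(complex^2^2 \<Rightarrow> complex) \<Rightarrow> bool" where
  const: "entry_polynomial (\<lambda>g. c)"
| entry: "entry_polynomial (\<lambda>g. g $ i $ j)"
| add: "entry_polynomial p \<Longrightarrow> entry_polynomial q \<Longrightarrow> entry_polynomial (\<lambda>g. p g + q g)"
| mult: "entry_polynomial p \<Longrightarrow> entry_polynomial q \<Longrightarrow> entry_polynomial (\<lambda>g. p g * q g)"

text \<open>A finite-dimensional algebraic representation on the subspace \<open>V\<close> of an ambient complex
  vector space. The carrier \<open>V\<close> is needed because binary forms and dual spaces are subspaces of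
  function types. \<open>\<rho>\<close> is constrained only on the group and on \<open>V\<close>. Algebraic means that all
  matrix coefficients are regular functions on the group; functionals on the ambient space are
  enough, as every functional on \<open>V\<close> extends to it.\<close>

locale SL2_module = vector_space scale
  for scale :: "complex \<Rightarrow> 'a::ab_group_add \<Rightarrow> 'a" +
  fixes V :: "'a set" and \<rho> :: "complex^2^2 \<Rightarrow> 'a \<Rightarrow> 'a"
  assumes carrier_subspace: "subspace V"
    and finite_dim: "\<exists>B. finite B \<and> span B = V"
    and act_closed: "g \<in> SL2 \<Longrightarrow> v \<in> V \<Longrightarrow> \<rho> g v \<in> V"
    and act_add: "g \<in> SL2 \<Longrightarrow> v \<in> V \<Longrightarrow> w \<in> V \<Longrightarrow> \<rho> g (v + w) = \<rho> g v + \<rho> g w"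
    and act_scale: "g \<in> SL2 \<Longrightarrow> v \<in> V \<Longrightarrow> \<rho> g (scale k v) = scale k (\<rho> g v)"
    and act_one: "v \<in> V \<Longrightarrow> \<rho> (mat 1) v = v"
    and act_mult: "g \<in> SL2 \<Longrightarrow> h \<in> SL2 \<Longrightarrow> v \<in> V \<Longrightarrow> \<rho> (g ** h) v = \<rho> g (\<rho> h v)"
    and algebraic: "v \<in> V \<Longrightarrow> Vector_Spaces.linear scale (*) l \<Longrightarrow>
          \<exists>p. entry_polynomial p \<and> (\<forall>g\<in>SL2. l (\<rho> g v) = p g)"

definition nontrivial_action :: "'a set \<Rightarrow> (complex^2^2 \<Rightarrow> 'a \<Rightarrow> 'a) \<Rightarrow> bool" where
  "nontrivial_action V \<rho> \<longleftrightarrow> (\<exists>g\<in>SL2. \<exists>v\<in>V. \<rho> g v \<noteq> v)"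

definition SL2_iso ::
  "(complex \<Rightarrow> 'a::ab_group_add \<Rightarrow> 'a) \<Rightarrow> 'a set \<Rightarrow> (complex^2^2 \<Rightarrow> 'a \<Rightarrow> 'a) \<Rightarrow>
   (complex \<Rightarrow> 'b::ab_group_add \<Rightarrow> 'b) \<Rightarrow> 'b set \<Rightarrow> (complex^2^2 \<Rightarrow> 'b \<Rightarrow> 'b) \<Rightarrow>
   ('a \<Rightarrow> 'b) \<Rightarrow> bool" where
  "SL2_iso scaleV V \<rho> scaleW W \<sigma> T \<longleftrightarrow>
     bij_betw T V W \<and>
     (\<forall>v\<in>V. \<forall>w\<in>V. T (v + w) = T v + T w) \<and>
     (\<forall>k. \<forall>v\<in>V. T (scaleV k v) = scaleW k (T v)) \<and>
     (\<forall>g\<in>SL2. \<forall>v\<in>V. T (\<rho> g v) = \<sigma> g (T v))"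

definition fun_scale :: "complex \<Rightarrow> ('x \<Rightarrow> complex) \<Rightarrow> 'x \<Rightarrow> complex" where
  "fun_scale k f = (\<lambda>x. k * f x)"


section \<open>Binary forms\<close>

text \<open>Forms of degree \<open>i\<close> in the coordinates \<open>x = v $ 1\<close> and \<open>y = v $ 2\<close>, identified with the
  functions they induce, which loses nothing over an infinite field. With \<open>g\<close> acting by
  \<open>v \<mapsto> v v* g\<close> in the argument, \<open>x\<close> goes to \<open>g\<^sub>1\<^sub>1 x + g\<^sub>2\<^sub>1 y\<close> and \<open>y\<close> to \<open>g\<^sub>1\<^sub>2 x + g\<^sub>2\<^sub>2 y\<close>: this is
  the \<open>i\<close>-th symmetric power of the standard representation with basis \<open>x, y\<close>.\<close>

definition binary_forms :: "nat \<Rightarrow> (complex^2 \<Rightarrow> complex) set" where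
  "binary_forms i = {f. \<exists>c. f = (\<lambda>v. \<Sum>k\<le>i. c k * ((v $ 1) ^ (i - k) * (v $ 2) ^ k))}"

definition forms_action :: "complex^2^2 \<Rightarrow> (complex^2 \<Rightarrow> complex) \<Rightarrow> complex^2 \<Rightarrow> complex" where
  "forms_action g f = (\<lambda>v. f (v v* g))"


section \<open>Dual modules\<close>

definition dual_space :: "(complex \<Rightarrow> 'a::ab_group_add \<Rightarrow> 'a) \<Rightarrow> ('a \<Rightarrow> complex) set" where
  "dual_space scaleV = {l. Vector_Spaces.linear scaleV (*) l}"

definition dual_action ::
  "(complex^2^2 \<Rightarrow> 'a \<Rightarrow> 'a) \<Rightarrow> complex^2^2 \<Rightarrow> ('a \<Rightarrow> complex) \<Rightarrow> 'a \<Rightarrow> complex" where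
  "dual_action \<rho> g l = (\<lambda>v. l (\<rho> (matrix_inv g) v))"


section \<open>Hyperplanes in the projective space of a triple tensor product\<close>

text \<open>A linear form on the tensor product of \<open>A\<close>, \<open>B\<close>, \<open>C\<close> is a trilinear form \<open>\<phi>\<close>, and its
  curried version \<open>\<lambda>a b. \<phi> a b\<close> is the bilinear map from \<open>A\<close>, \<open>B\<close> to the dual of \<open>C\<close>. A
  hyperplane is represented by a nonzero form; all notions below are invariant under nonzero
  scaling of \<open>\<phi>\<close>.\<close>

definition hyperplane_form ::
  "(complex \<Rightarrow> 'a::ab_group_add \<Rightarrow> 'a) \<Rightarrow> (complex \<Rightarrow> 'b::ab_group_add \<Rightarrow> 'b) \<Rightarrow>
   (complex \<Rightarrow> 'c::ab_group_add \<Rightarrow> 'c) \<Rightarrow> ('a \<Rightarrow> 'b \<Rightarrow> 'c \<Rightarrow> complex) \<Rightarrow> bool" where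
  "hyperplane_form scaleA scaleB scaleC \<phi> \<longleftrightarrow>
     (\<forall>b c. Vector_Spaces.linear scaleA (*) (\<lambda>a. \<phi> a b c)) \<and>
     (\<forall>a c. Vector_Spaces.linear scaleB (*) (\<lambda>b. \<phi> a b c)) \<and>
     (\<forall>a b. Vector_Spaces.linear scaleC (*) (\<lambda>c. \<phi> a b c)) \<and>
     (\<exists>a b c. \<phi> a b c \<noteq> 0)"

text \<open>The group maps the hyperplane, a form up to a scalar, to itself; the scalar may a priori
  depend on the group element.\<close>

definition hyperplane_invariant ::
  "(complex^2^2 \<Rightarrow> 'a \<Rightarrow> 'a) \<Rightarrow> (complex^2^2 \<Rightarrow> 'b \<Rightarrow> 'b) \<Rightarrow> (complex^2^2 \<Rightarrow> 'c \<Rightarrow> 'c) \<Rightarrow>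
   ('a \<Rightarrow> 'b \<Rightarrow> 'c \<Rightarrow> complex) \<Rightarrow> bool" where
  "hyperplane_invariant \<rho>A \<rho>B \<rho>C \<phi> \<longleftrightarrow>
     (\<forall>g\<in>SL2. \<exists>k. k \<noteq> 0 \<and>
        (\<forall>a b c. \<phi> (\<rho>A (matrix_inv g) a) (\<rho>B (matrix_inv g) b) (\<rho>C (matrix_inv g) c)
                   = k * \<phi> a b c))"

text \<open>The tangent space of the Segre variety at the class of \<open>a \<otimes> b \<otimes> c\<close> is spanned by the
  tensors \<open>a' \<otimes> b \<otimes> c\<close>, \<open>a \<otimes> b' \<otimes> c\<close> and \<open>a \<otimes> b \<otimes> c'\<close>.\<close>

definition tangent_at ::
  "('a \<Rightarrow> 'b \<Rightarrow> 'c \<Rightarrow> complex) \<Rightarrow> 'a \<Rightarrow> 'b \<Rightarrow> 'c \<Rightarrow> bool" where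
  "tangent_at \<phi> a b c \<longleftrightarrow>
     (\<forall>a'. \<phi> a' b c = 0) \<and> (\<forall>b'. \<phi> a b' c = 0) \<and> (\<forall>c'. \<phi> a b c' = 0)"

text \<open>In boundary format the hyperdeterminant is the equation, unique up to a scalar, of the
  variety of hyperplanes tangent to the Segre variety, so it does not vanish exactly when the
  hyperplane is nowhere tangent.\<close>

definition Det_nonzero ::
  "('a::zero \<Rightarrow> 'b::zero \<Rightarrow> 'c::zero \<Rightarrow> complex) \<Rightarrow> bool" where
  "Det_nonzero \<phi> \<longleftrightarrow> \<not> (\<exists>a b c. a \<noteq> 0 \<and> b \<noteq> 0 \<and> c \<noteq> 0 \<and> tangent_at \<phi> a b c)"

text \<open>The product of forms is the pointwise product \<open>(*)\<close> of functions.\<close>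

definition is_multiplication ::
  "nat \<Rightarrow> nat \<Rightarrow>
   (complex \<Rightarrow> 'a::ab_group_add \<Rightarrow> 'a) \<Rightarrow> (complex^2^2 \<Rightarrow> 'a \<Rightarrow> 'a) \<Rightarrow>
   (complex \<Rightarrow> 'b::ab_group_add \<Rightarrow> 'b) \<Rightarrow> (complex^2^2 \<Rightarrow> 'b \<Rightarrow> 'b) \<Rightarrow>
   (complex \<Rightarrow> 'c::ab_group_add \<Rightarrow> 'c) \<Rightarrow> (complex^2^2 \<Rightarrow> 'c \<Rightarrow> 'c) \<Rightarrow>
   ('a \<Rightarrow> 'b \<Rightarrow> 'c \<Rightarrow> complex) \<Rightarrow> bool" where
  "is_multiplication n m scaleA \<rho>A scaleB \<rho>B scaleC \<rho>C \<phi> \<longleftrightarrow>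
     (\<exists>\<alpha> \<beta> \<gamma> k.
        SL2_iso scaleA UNIV \<rho>A fun_scale (binary_forms n) forms_action \<alpha> \<and>
        SL2_iso scaleB UNIV \<rho>B fun_scale (binary_forms m) forms_action \<beta> \<and>
        SL2_iso fun_scale (dual_space scaleC) (dual_action \<rho>C)
                fun_scale (binary_forms (n + m)) forms_action \<gamma> \<and>
        k \<noteq> 0 \<and> (\<forall>a b. \<gamma> (\<phi> a b) = fun_scale k (\<alpha> a * \<beta> b)))"

end

theory Submission
  imports Defs
begin

text \<open>Write \<open>D\<close> for the dual of \<open>C\<close>. Nonvanishing of the hyperdeterminant means that \<open>\<phi>(a, b) \<noteq> 0\<close>
  for nonzero \<open>a\<close> and \<open>b\<close>, and by Hopf's bound such a bilinear map satisfies
  \<open>dim A + dim B \<le> dim D + 1\<close>. Applied to the spans of the vectors of weight at least \<open>a\<^sub>i\<close>, respectively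
  \<open>b\<^sub>j\<close>, and of weight at most these, this forces \<open>d\<^sub>i\<^sub>+\<^sub>j = a\<^sub>i + b\<^sub>j\<close> for the decreasingly ordered weights of
  the three modules, which are therefore arithmetic progressions with a common step \<open>\<delta>\<close>.
  The coordinate of \<open>h v\<close> along the highest weight vector depends only on the first row \<open>(x, y)\<close> of \<open>h\<close>,
  which gives an equivariant map from each module to the binary forms in \<open>x, y\<close>; it sends a weight vector to a multiple
  of a monomial, hits every monomial, and turns \<open>\<phi>\<close> into the product of forms. Hitting all the monomials
  leaves \<open>\<delta> = 1\<close> or \<open>\<delta> = 2\<close>. If \<open>\<delta> = 1\<close>, the map for \<open>D\<close> does not vanish on \<open>\<phi>(e\<^sub>1, f\<^sub>1)\<close>, which has
  the weight \<open>d\<^sub>0 - 2\<close>, but the one for \<open>A\<close> kills \<open>e\<^sub>1\<close>, of weight \<open>a\<^sub>0 - 1\<close>. So \<open>\<delta> = 2\<close> and the three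
  maps are isomorphisms.\<close>

section \<open>Hopf's lower bound for the target of a nondegenerate complex bilinear map\<close>

section \<open>Nondegenerate bilinear maps\<close>

text \<open>Gaussian elimination, by induction on the equations: a row \<open>e0\<close> with a
  nonzero coefficient at \<open>x0\<close> removes \<open>x0\<close> from the other rows, which
  leaves one equation and one unknown fewer.\<close>

lemma homogeneous_system_nontrivial_solution:
  fixes M :: "'r \<Rightarrow> 'v \<Rightarrow> 'k::field"
  assumes "finite E" "finite X" "card E < card X"
  shows "\<exists>z. (\<exists>x\<in>X. z x \<noteq> 0) \<and> (\<forall>e\<in>E. (\<Sum>x\<in>X. M e x * z x) = 0)"
  using assms
proof (induction E arbitrary: M X rule: finite_induct)
  case empty
  then have "X \<noteq> {}" by auto
  then show ?case by (intro exI[of _ "\<lambda>_. 1"]) auto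
next
  case (insert e0 E)
  show ?case
  proof (cases "\<forall>x\<in>X. M e0 x = 0")
    case True
    obtain z where z: "\<exists>x\<in>X. z x \<noteq> 0" "\<forall>e\<in>E. (\<Sum>x\<in>X. M e x * z x) = 0"
      using insert.IH[of X M] insert.prems insert.hyps by auto
    then show ?thesis using True by (intro exI[of _ z]) auto
  next
    case False
    then obtain x0 where x0: "x0 \<in> X" "M e0 x0 \<noteq> 0" by auto
    \<comment> \<open>Row \<open>e\<close> minus the multiple of row \<open>e0\<close> that cancels
      its coefficient at \<open>x0\<close>.\<close>
    define N where "N = (\<lambda>e x. M e x - M e x0 * M e0 x / M e0 x0)"
    have "card E < card (X - {x0})"
      using insert.prems insert.hyps x0 by simp
    then obtain z where z: "\<exists>x\<in>X - {x0}. z x \<noteq> 0"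
        "\<forall>e\<in>E. (\<Sum>x\<in>X - {x0}. N e x * z x) = 0"
      using insert.IH[of "X - {x0}" N] insert.prems by auto
    define s where "s = - (\<Sum>x\<in>X - {x0}. M e0 x * z x) / M e0 x0"
    define y where "y = z(x0 := s)"
    have sum_y: "(\<Sum>x\<in>X. M e x * y x) = M e x0 * s + (\<Sum>x\<in>X - {x0}. M e x * z x)" for e
    proof -
      have "(\<Sum>x\<in>X. M e x * y x) = M e x0 * y x0 + (\<Sum>x\<in>X - {x0}. M e x * y x)"
        using insert.prems(1) x0(1) by (rule sum.remove)
      also have "(\<Sum>x\<in>X - {x0}. M e x * y x) = (\<Sum>x\<in>X - {x0}. M e x * z x)"
        by (rule sum.cong) (auto simp: y_def)
      finally show ?thesis by (simp add: y_def)
    qed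
    have "(\<Sum>x\<in>X. M e x * y x) = 0" if "e \<in> insert e0 E" for e
    proof (cases "e = e0")
      case True
      then show ?thesis using x0(2) by (simp only: sum_y) (simp add: s_def)
    next
      case False
      then have "e \<in> E" using that by simp
      then have "0 = (\<Sum>x\<in>X - {x0}. N e x * z x)" using z(2) by simp
      also have "\<dots> = (\<Sum>x\<in>X - {x0}. M e x * z x - M e x0 / M e0 x0 * (M e0 x * z x))"
        by (rule sum.cong) (auto simp: N_def field_simps)
      also have "\<dots> = (\<Sum>x\<in>X - {x0}. M e x * z x) + M e x0 * s"
        by (simp only: sum_subtractf sum_distrib_left[symmetric]) (simp add: s_def)
      finally show ?thesis by (simp only: sum_y) (simp add: add.commute)
    qed
    moreover have "\<exists>x\<in>X. y x \<noteq> 0" using z(1) by (auto simp: y_def)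
    ultimately show ?thesis by blast
  qed
qed

definition sumsq :: "'s set \<Rightarrow> ('s \<Rightarrow> complex) \<Rightarrow> real" where
  "sumsq S u = (\<Sum>s\<in>S. (cmod (u s))\<^sup>2)"

lemma sumsq_nonneg: "0 \<le> sumsq S u"
  by (simp add: sumsq_def sum_nonneg)

lemma sumsq_eq_0: "finite S \<Longrightarrow> sumsq S u = 0 \<longleftrightarrow> (\<forall>s\<in>S. u s = 0)"
  by (simp add: sumsq_def sum_nonneg_eq_0_iff)

lemma sumsq_scale: "sumsq S (\<lambda>s. k * u s) = (cmod k)\<^sup>2 * sumsq S u"
  by (simp add: sumsq_def norm_mult power_mult_distrib sum_distrib_left)

lemma sumsq_cong: "(\<And>s. s \<in> S \<Longrightarrow> u s = v s) \<Longrightarrow> sumsq S u = sumsq S v"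
  by (simp add: sumsq_def)

lemma sumsq_parallelogram:
  "sumsq S (\<lambda>s. u s + v s) + sumsq S (\<lambda>s. u s - v s) = 2 * sumsq S u + 2 * sumsq S v"
proof -
  have "(cmod (z + w))\<^sup>2 + (cmod (z - w))\<^sup>2 = 2 * (cmod z)\<^sup>2 + 2 * (cmod w)\<^sup>2" for z w
    unfolding cmod_power2 by (simp add: power2_eq_square algebra_simps)
  then show ?thesis
    by (simp add: sumsq_def sum.distrib[symmetric] sum_distrib_left)
qed

lemma sumsq_orthogonal:
  assumes "(\<Sum>s\<in>S. cnj (u s) * v s) = 0"
  shows "sumsq S (\<lambda>s. u s + v s) = sumsq S u + sumsq S v"
proof -
  have "(cmod (z + w))\<^sup>2 = (cmod z)\<^sup>2 + (cmod w)\<^sup>2 + 2 * Re (cnj z * w)" for z w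
    unfolding cmod_power2 by (simp add: power2_eq_square algebra_simps)
  then have "sumsq S (\<lambda>s. u s + v s)
      = sumsq S u + sumsq S v + 2 * Re (\<Sum>s\<in>S. cnj (u s) * v s)"
    by (simp add: sumsq_def sum.distrib sum_distrib_left)
  then show ?thesis using assms by simp
qed

text \<open>Functions have to vanish off \<open>S\<close>, as free coordinates would destroy
  compactness. The sphere is then closed in a product of closed discs and points, which is compact
  by Tychonoff's theorem.\<close>

lemma compact_unit_sphere_functions:
  assumes "finite S"
  shows "compact {u :: 's \<Rightarrow> complex. (\<forall>s. s \<notin> S \<longrightarrow> u s = 0) \<and> sumsq S u = 1}"
proof -
  let ?P = "PiE UNIV (\<lambda>s. if s \<in> S then cball (0::complex) 1 else {0})"
  have "compact ?P"
    using compactin_PiE[of "\<lambda>_. euclidean" UNIV "\<lambda>s. if s \<in> S then cball (0::complex) 1 else {0}"]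
    by (auto simp: euclidean_product_topology)
  moreover have "closed {u :: 's \<Rightarrow> complex. sumsq S u = 1}"
    unfolding sumsq_def
    by (intro closed_Collect_eq continuous_intros) auto
  ultimately have "compact (?P \<inter> {u. sumsq S u = 1})" by (rule compact_Int_closed)
  moreover have "?P \<inter> {u. sumsq S u = 1}
      = {u. (\<forall>s. s \<notin> S \<longrightarrow> u s = 0) \<and> sumsq S u = 1}"
  proof -
    have "cmod (u s) \<le> 1" if "sumsq S u = 1" "s \<in> S" for u :: "'s \<Rightarrow> complex" and s
    proof -
      have "(cmod (u s))\<^sup>2 \<le> sumsq S u"
        unfolding sumsq_def using assms that(2) by (intro member_le_sum) auto
      then show ?thesis using that(1) by (simp add: abs_square_le_1)
    qed
    then show ?thesis by (auto simp: PiE_iff split: if_splits)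
  qed
  ultimately show ?thesis by simp
qed

text \<open>At a minimum \<open>(u, v)\<close> of the norm of the bilinear map on the product of the unit spheres,
  too small a target leaves a nonzero \<open>(u', v')\<close> in the kernel of the differential with \<open>u'\<close>
  orthogonal to \<open>u\<close>. Averaging over \<open>(u + t u', v + t v')\<close> for \<open>t = \<plusminus>r, \<plusminus>\<i>r\<close> kills all the first and
  second order terms of the norm of the image, but not those of the product of the norms.\<close>

lemma nondegenerate_bilinear_card:
  fixes T :: "'i \<Rightarrow> 'j \<Rightarrow> 'l \<Rightarrow> complex"
  assumes fin: "finite I" "finite J" "finite L" and ne: "I \<noteq> {}" "J \<noteq> {}"
    and nondeg: "\<And>u v. \<exists>i\<in>I. u i \<noteq> 0 \<Longrightarrow> \<exists>j\<in>J. v j \<noteq> 0 \<Longrightarrow>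
      \<exists>l\<in>L. (\<Sum>i\<in>I. \<Sum>j\<in>J. u i * v j * T i j l) \<noteq> 0"
  shows "card I + card J \<le> card L + 1"
proof (rule ccontr)
  assume "\<not> ?thesis"
  then have small: "card L + 1 < card I + card J" by simp
  define b where "b = (\<lambda>u v l. \<Sum>i\<in>I. \<Sum>j\<in>J. u i * v j * T i j l)"
  define F where "F = (\<lambda>u v. sumsq L (b u v))"
  define KI where "KI = {u :: 'i \<Rightarrow> complex. (\<forall>s. s \<notin> I \<longrightarrow> u s = 0) \<and> sumsq I u = 1}"
  define KJ where "KJ = {u :: 'j \<Rightarrow> complex. (\<forall>s. s \<notin> J \<longrightarrow> u s = 0) \<and> sumsq J u = 1}"
  have "compact (KI \<times> KJ)"
    unfolding KI_def KJ_def using fin by (intro compact_Times compact_unit_sphere_functions)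
  moreover have "KI \<times> KJ \<noteq> {}"
  proof -
    obtain i j where "i \<in> I" "j \<in> J" using ne by auto
    moreover have "sumsq S (\<lambda>x. if x = s then 1 else 0) = 1" if "finite S" "s \<in> S" for S and s :: 's
    proof -
      have "(cmod (if x = s then 1 else 0))\<^sup>2 = (if x = s then 1 else 0)" for x :: 's by simp
      then show ?thesis using that by (simp add: sumsq_def)
    qed
    ultimately have "(\<lambda>x. if x = i then 1 else 0) \<in> KI" "(\<lambda>x. if x = j then 1 else 0) \<in> KJ"
      using fin by (auto simp: KI_def KJ_def)
    then show ?thesis by auto
  qed
  moreover have "continuous_on (KI \<times> KJ) (\<lambda>p. F (fst p) (snd p))"
  proof -
    have "continuous_on S (\<lambda>p. fst p i)" for S :: "(('i \<Rightarrow> complex) \<times> ('j \<Rightarrow> complex)) set" and i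
      by (rule continuous_on_product_then_coordinatewise) (intro continuous_intros)
    moreover have "continuous_on S (\<lambda>p. snd p j)"
      for S :: "(('i \<Rightarrow> complex) \<times> ('j \<Rightarrow> complex)) set" and j
      by (rule continuous_on_product_then_coordinatewise) (intro continuous_intros)
    ultimately show ?thesis unfolding F_def sumsq_def b_def by (intro continuous_intros)
  qed
  ultimately obtain p where p: "p \<in> KI \<times> KJ" "\<forall>q\<in>KI \<times> KJ. F (fst p) (snd p) \<le> F (fst q) (snd q)"
    using continuous_attains_inf by blast
  define u v where "u = fst p" and "v = snd p"
  define \<mu> where "\<mu> = F u v"
  have u: "sumsq I u = 1" and v: "sumsq J v = 1" using p(1) by (auto simp: u_def v_def KI_def KJ_def)
  have b_scale: "b (\<lambda>i. x * u' i) (\<lambda>j. y * v' j) l = x * y * b u' v' l" for x y u' v' l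
    by (simp add: b_def sum_distrib_left mult_ac)
  have b_cong: "b u' v' = b u'' v''" if "\<forall>i\<in>I. u' i = u'' i" "\<forall>j\<in>J. v' j = v'' j" for u' v' u'' v''
    using that by (intro ext) (auto simp: b_def intro!: sum.cong)
  have "\<mu> > 0"
  proof -
    have "\<exists>i\<in>I. u i \<noteq> 0" "\<exists>j\<in>J. v j \<noteq> 0"
      using u v sumsq_eq_0[OF fin(1), of u] sumsq_eq_0[OF fin(2), of v] by auto
    then have "\<exists>l\<in>L. b u v l \<noteq> 0" unfolding b_def by (rule nondeg)
    then have "\<mu> \<noteq> 0" unfolding \<mu>_def F_def using sumsq_eq_0[OF fin(3)] by blast
    then show ?thesis using sumsq_nonneg[of L "b u v"] by (simp add: \<mu>_def F_def)
  qed
  \<comment> \<open>Homogeneity carries the minimum over the unit spheres to all pairs; the rescaled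
    functions are cut off outside \<open>I\<close> and \<open>J\<close> to lie in \<open>KI\<close>
    and \<open>KJ\<close>.\<close>
  have min: "\<mu> * sumsq I x * sumsq J y \<le> F x y" for x y
  proof (cases "sumsq I x = 0 \<or> sumsq J y = 0")
    case True
    then show ?thesis by (auto simp: F_def sumsq_nonneg)
  next
    case False
    then have pos: "sumsq I x > 0" "sumsq J y > 0" using sumsq_nonneg by (metis less_eq_real_def)+
    define r s where "r = complex_of_real (1 / sqrt (sumsq I x))"
      and "s = complex_of_real (1 / sqrt (sumsq J y))"
    have rs: "(cmod r)\<^sup>2 = 1 / sumsq I x" "(cmod s)\<^sup>2 = 1 / sumsq J y"
      using pos by (simp_all add: r_def s_def norm_divide power_divide)
    define x' y' where "x' = (\<lambda>i. if i \<in> I then r * x i else 0)"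
      and "y' = (\<lambda>j. if j \<in> J then s * y j else 0)"
    have "sumsq I x' = sumsq I (\<lambda>i. r * x i)" "sumsq J y' = sumsq J (\<lambda>j. s * y j)"
      by (auto intro!: sumsq_cong simp: x'_def y'_def)
    then have "x' \<in> KI" "y' \<in> KJ"
      using pos by (auto simp: KI_def KJ_def sumsq_scale rs) (auto simp: x'_def y'_def)
    then have "\<mu> \<le> F x' y'" using p(2) by (auto simp: \<mu>_def u_def v_def)
    also have "b x' y' = b (\<lambda>i. r * x i) (\<lambda>j. s * y j)"
      by (rule b_cong) (auto simp: x'_def y'_def)
    then have "F x' y' = sumsq L (\<lambda>l. r * s * b x y l)" by (simp add: F_def sumsq_def b_scale)
    also have "\<dots> = F x y / (sumsq I x * sumsq J y)"
      by (simp add: sumsq_scale F_def norm_mult power_mult_distrib rs)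
    finally show ?thesis using pos by (simp add: field_simps)
  qed
  \<comment> \<open>The linear system for \<open>(u', v')\<close>, stacked as one unknown on
    \<open>I <+> J\<close>: row \<open>None\<close> says that \<open>u'\<close> is orthogonal to
    \<open>u\<close>, row \<open>Some l\<close> is coordinate \<open>l\<close> of the differential
    of \<open>b\<close> at \<open>(u, v)\<close>. These are \<open>card L + 1\<close>
    equations.\<close>
  define d where "d = (\<lambda>k x. case k of
      None \<Rightarrow> (case x of Inl i \<Rightarrow> cnj (u i) | Inr j \<Rightarrow> 0)
    | Some l \<Rightarrow> (case x of Inl i \<Rightarrow> (\<Sum>j\<in>J. v j * T i j l) | Inr j \<Rightarrow> (\<Sum>i\<in>I. u i * T i j l)))"
  have "card (insert None (Some ` L)) < card (I <+> J)"
    using small fin by (simp add: card_Plus card_image)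
  then obtain z where z: "\<exists>x\<in>I <+> J. z x \<noteq> 0"
      "\<forall>k\<in>insert None (Some ` L). (\<Sum>x\<in>I <+> J. d k x * z x) = 0"
    using homogeneous_system_nontrivial_solution[of "insert None (Some ` L)" "I <+> J" d] fin by auto
  define u' v' where "u' = (\<lambda>i. z (Inl i))" and "v' = (\<lambda>j. z (Inr j))"
  define U W G where "U = sumsq I u'" and "W = sumsq J v'" and "G = F u' v'"
  have sumIJ: "(\<Sum>x\<in>I <+> J. d k x * z x)
      = (\<Sum>i\<in>I. d k (Inl i) * u' i) + (\<Sum>j\<in>J. d k (Inr j) * v' j)" for k
    using fin by (simp add: sum.Plus u'_def v'_def)
  have orth: "(\<Sum>i\<in>I. cnj (u i) * u' i) = 0"
    using z(2) sumIJ[of None] by (simp add: d_def)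
  have ker: "b u' v l + b u v' l = 0" if "l \<in> L" for l
  proof -
    have "0 = (\<Sum>i\<in>I. (\<Sum>j\<in>J. v j * T i j l) * u' i) + (\<Sum>j\<in>J. (\<Sum>i\<in>I. u i * T i j l) * v' j)"
      using z(2) sumIJ[of "Some l"] that by (simp add: d_def)
    also have "(\<Sum>i\<in>I. (\<Sum>j\<in>J. v j * T i j l) * u' i) = b u' v l"
      by (simp add: b_def sum_distrib_left sum_distrib_right mult_ac)
    also have "(\<Sum>j\<in>J. (\<Sum>i\<in>I. u i * T i j l) * v' j) = b u v' l"
      unfolding b_def by (subst sum.swap) (simp add: sum_distrib_left sum_distrib_right mult_ac)
    finally show ?thesis by simp
  qed
  have "U + W > 0"
  proof -
    have "U \<noteq> 0 \<or> W \<noteq> 0"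
      using z(1) fin by (auto simp: U_def W_def sumsq_eq_0 u'_def v'_def)
    then show ?thesis using sumsq_nonneg[of I u'] sumsq_nonneg[of J v'] by (auto simp: U_def W_def)
  qed
  have b_add: "b (\<lambda>i. x i + x' i) (\<lambda>j. y j + y' j) l = b x y l + (b x' y l + b x y' l) + b x' y' l"
    for x x' y y' l by (simp add: b_def algebra_simps sum.distrib)
  \<comment> \<open>The part linear in \<open>t\<close> vanishes by \<open>ker\<close>, so only
    \<open>t\<^sup>2\<close> enters and \<open>t\<close>, \<open>- t\<close> give the same
    value.\<close>
  have Ft: "F (\<lambda>i. u i + t * u' i) (\<lambda>j. v j + t * v' j) = sumsq L (\<lambda>l. b u v l + t\<^sup>2 * b u' v' l)" for t
    unfolding F_def
  proof (rule sumsq_cong)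
    fix l assume "l \<in> L"
    have "b (\<lambda>i. t * u' i) v l = t * b u' v l" "b u (\<lambda>j. t * v' j) l = t * b u v' l"
      using b_scale[of t u' 1 v] b_scale[of 1 u t v'] by simp_all
    then have "b (\<lambda>i. u i + t * u' i) (\<lambda>j. v j + t * v' j) l
        = b u v l + t * (b u' v l + b u v' l) + t * t * b u' v' l"
      by (simp only: b_add b_scale) (simp add: algebra_simps)
    then show "b (\<lambda>i. u i + t * u' i) (\<lambda>j. v j + t * v' j) l = b u v l + t\<^sup>2 * b u' v' l"
      using ker[OF \<open>l \<in> L\<close>] by (simp add: power2_eq_square)
  qed
  have lower: "\<mu> * (1 + (cmod t)\<^sup>2 * U) * (1 + (cmod t)\<^sup>2 * W)
      \<le> sumsq L (\<lambda>l. b u v l + t\<^sup>2 * b u' v' l)" for t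
  proof -
    have ut: "sumsq I (\<lambda>i. u i + t * u' i) = 1 + (cmod t)\<^sup>2 * U" for t
    proof -
      have "(\<Sum>i\<in>I. cnj (u i) * (t * u' i)) = t * (\<Sum>i\<in>I. cnj (u i) * u' i)"
        by (simp add: sum_distrib_left mult_ac)
      then show ?thesis using orth by (subst sumsq_orthogonal) (simp_all add: u sumsq_scale U_def)
    qed
    \<comment> \<open>Unlike \<open>u'\<close>, the vector \<open>v'\<close> need not be orthogonal
      to \<open>v\<close>; adding the cases \<open>t\<close> and \<open>- t\<close> cancels the
      cross term.\<close>
    have vt: "sumsq J (\<lambda>j. v j + t * v' j) + sumsq J (\<lambda>j. v j + (- t) * v' j) = 2 * (1 + (cmod t)\<^sup>2 * W)"
      using sumsq_parallelogram[of J v "\<lambda>j. t * v' j"] by (simp add: sumsq_scale v W_def)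
    have "\<mu> * (1 + (cmod t)\<^sup>2 * U) * sumsq J (\<lambda>j. v j + t * v' j)
        \<le> sumsq L (\<lambda>l. b u v l + t\<^sup>2 * b u' v' l)"
      using min[of "\<lambda>i. u i + t * u' i" "\<lambda>j. v j + t * v' j"] unfolding Ft ut by simp
    moreover have "\<mu> * (1 + (cmod t)\<^sup>2 * U) * sumsq J (\<lambda>j. v j + (- t) * v' j)
        \<le> sumsq L (\<lambda>l. b u v l + t\<^sup>2 * b u' v' l)"
      using min[of "\<lambda>i. u i + (- t) * u' i" "\<lambda>j. v j + (- t) * v' j"] unfolding Ft ut by simp
    moreover have double: "c * x \<le> s \<Longrightarrow> c * y \<le> s \<Longrightarrow> c * (x + y) \<le> 2 * s" for c x y s :: real
      by (simp add: distrib_left)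
    ultimately have "\<mu> * (1 + (cmod t)\<^sup>2 * U) * (2 * (1 + (cmod t)\<^sup>2 * W))
        \<le> 2 * sumsq L (\<lambda>l. b u v l + t\<^sup>2 * b u' v' l)"
      using double unfolding vt[symmetric] by blast
    then show ?thesis by linarith
  qed
  have bound: "\<mu> * (U + W) \<le> r * G" if "r > 0" for r
  proof -
    \<comment> \<open>The squares of \<open>t\<close> and \<open>\<i> * t\<close> are
      \<open>r\<close> and \<open>- r\<close>, so the parallelogram law removes the term of order
      \<open>r\<close> from the norm of the image, while the product of the norms grows to that
      order.\<close>
    define t where "t = complex_of_real (sqrt r)"
    have t: "t\<^sup>2 = complex_of_real r" "(\<i> * t)\<^sup>2 = - complex_of_real r" "(cmod t)\<^sup>2 = r" "(cmod (\<i> * t))\<^sup>2 = r"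
      using that by (simp_all add: t_def power_mult_distrib norm_mult flip: of_real_power)
    have "2 * (\<mu> * (1 + r * U) * (1 + r * W))
      \<le> sumsq L (\<lambda>l. b u v l + r * b u' v' l) + sumsq L (\<lambda>l. b u v l - r * b u' v' l)"
      using lower[of t] lower[of "\<i> * t"] unfolding t by simp
    also have "\<dots> = 2 * \<mu> + 2 * (r\<^sup>2 * G)"
      using that by (simp add: sumsq_parallelogram sumsq_scale \<mu>_def F_def G_def)
    finally have "\<mu> * (1 + r * U) * (1 + r * W) \<le> \<mu> + r\<^sup>2 * G" by simp
    moreover have "\<mu> * (1 + r * U) * (1 + r * W) \<ge> \<mu> + r * (\<mu> * (U + W))"
    proof -
      have "\<mu> * (r * U) * (r * W) \<ge> 0"
        using \<open>\<mu> > 0\<close> that sumsq_nonneg[of I u'] sumsq_nonneg[of J v'] by (simp add: U_def W_def)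
      then show ?thesis by (simp add: algebra_simps)
    qed
    ultimately have "r * (\<mu> * (U + W)) \<le> r * (r * G)" by (simp add: power2_eq_square)
    then show ?thesis using that by simp
  qed
  have "\<mu> * (U + W) > 0" using \<open>\<mu> > 0\<close> \<open>U + W > 0\<close> by simp
  have "G \<ge> 0" by (simp add: G_def F_def sumsq_nonneg)
  define \<epsilon> where "\<epsilon> = \<mu> * (U + W)"
  \<comment> \<open>Small enough for \<open>r * G\<close> to be at most
    \<open>\<epsilon> / 2\<close>; the summand \<open>1\<close> guards against
    \<open>G = 0\<close>.\<close>
  define r where "r = \<epsilon> / (2 * (G + 1))"
  have "\<epsilon> > 0" using \<open>\<mu> * (U + W) > 0\<close> by (simp add: \<epsilon>_def)
  then have "r > 0" using \<open>G \<ge> 0\<close> by (simp add: r_def)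
  have "r * G \<le> r * (G + 1)" using \<open>r > 0\<close> by simp
  also have "\<dots> = \<epsilon> / 2" using \<open>G \<ge> 0\<close> by (simp add: r_def field_simps)
  finally show False using bound[OF \<open>r > 0\<close>] \<open>\<epsilon> > 0\<close> unfolding \<epsilon>_def by linarith
qed

section \<open>Elementary matrices, the torus, and triviality of characters\<close>

section \<open>Generators of the special linear group\<close>

definition mat2 :: "complex \<Rightarrow> complex \<Rightarrow> complex \<Rightarrow> complex \<Rightarrow> complex^2^2" where
  "mat2 a b c d = vector [vector [a, b], vector [c, d]]"

lemma mat2_nth [simp]:
  "mat2 a b c d $ 1 $ 1 = a" "mat2 a b c d $ 1 $ 2 = b"
  "mat2 a b c d $ 2 $ 1 = c" "mat2 a b c d $ 2 $ 2 = d"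
  by (simp_all add: mat2_def)

lemma mat2_eq_iff: "g = mat2 a b c d \<longleftrightarrow> g $ 1 $ 1 = a \<and> g $ 1 $ 2 = b \<and> g $ 2 $ 1 = c \<and> g $ 2 $ 2 = d"
  by (auto simp: vec_eq_iff forall_2)

lemma mat2_mult: "mat2 a b c d ** mat2 a' b' c' d'
    = mat2 (a * a' + b * c') (a * b' + b * d') (c * a' + d * c') (c * b' + d * d')"
  unfolding mat2_eq_iff by (simp add: matrix_matrix_mult_def sum_2)

lemma mat2_in_SL2 [simp]: "mat2 a b c d \<in> SL2 \<longleftrightarrow> a * d - b * c = 1"
  by (simp add: SL2_def det_2)

lemma SL2_cases:
  assumes "g \<in> SL2"
  obtains a b c d where "g = mat2 a b c d" "a * d - b * c = 1"
proof -
  have "g = mat2 (g $ 1 $ 1) (g $ 1 $ 2) (g $ 2 $ 1) (g $ 2 $ 2)" by (simp add: mat2_eq_iff)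
  then show ?thesis using assms that by (metis mat2_in_SL2)
qed

lemma mat_1_eq_mat2: "mat 1 = mat2 1 0 0 1"
  by (simp add: mat2_eq_iff mat_def)

lemma mult_in_SL2 [simp]: "g \<in> SL2 \<Longrightarrow> h \<in> SL2 \<Longrightarrow> g ** h \<in> SL2"
  by (simp add: SL2_def det_mul)

lemma matrix_inv_unique:
  fixes A B :: "'a::field^'n^'n"
  assumes "A ** B = mat 1" "B ** A = mat 1"
  shows "matrix_inv A = B"
proof -
  have "A ** matrix_inv A = mat 1 \<and> matrix_inv A ** A = mat 1"
    unfolding matrix_inv_def by (rule someI[of _ B]) (simp add: assms)
  then have "matrix_inv A = matrix_inv A ** (A ** B)" by (simp add: assms)
  also have "\<dots> = B"
    using \<open>A ** matrix_inv A = mat 1 \<and> matrix_inv A ** A = mat 1\<close> by (simp add: matrix_mul_assoc)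
  finally show ?thesis .
qed

lemma matrix_inv_mat2:
  assumes "a * d - b * c = 1"
  shows "matrix_inv (mat2 a b c d) = mat2 d (- b) (- c) a"
  using assms by (intro matrix_inv_unique) (simp_all add: mat2_mult mat_1_eq_mat2 mat2_eq_iff algebra_simps)

lemma matrix_inv_in_SL2 [simp]: "g \<in> SL2 \<Longrightarrow> matrix_inv g \<in> SL2"
  by (erule SL2_cases) (simp add: matrix_inv_mat2 algebra_simps)

lemma matrix_inv_SL2:
  assumes "g \<in> SL2"
  shows "g ** matrix_inv g = mat 1" "matrix_inv g ** g = mat 1"
  using assms by (auto elim!: SL2_cases simp: matrix_inv_mat2 mat2_mult mat_1_eq_mat2 mat2_eq_iff algebra_simps)

lemma matrix_inv_mult_SL2:
  assumes "g \<in> SL2" "h \<in> SL2"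
  shows "matrix_inv (g ** h) = matrix_inv h ** matrix_inv g"
proof (rule matrix_inv_unique)
  have "(g ** h) ** (matrix_inv h ** matrix_inv g) = g ** (h ** matrix_inv h) ** matrix_inv g"
    by (simp add: matrix_mul_assoc)
  then show "(g ** h) ** (matrix_inv h ** matrix_inv g) = mat 1"
    using assms by (simp add: matrix_inv_SL2)
  have "(matrix_inv h ** matrix_inv g) ** (g ** h) = matrix_inv h ** (matrix_inv g ** g) ** h"
    by (simp add: matrix_mul_assoc)
  then show "(matrix_inv h ** matrix_inv g) ** (g ** h) = mat 1"
    using assms by (simp add: matrix_inv_SL2)
qed

lemma matrix_inv_matrix_inv_SL2: "g \<in> SL2 \<Longrightarrow> matrix_inv (matrix_inv g) = g"
  by (rule matrix_inv_unique) (simp_all add: matrix_inv_SL2)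

text \<open>At determinant one the inverse is the adjugate, whose entries are linear. This gives the
  continuity of dual representations.\<close>

lemma continuous_on_matrix_inv_SL2: "continuous_on SL2 (matrix_inv :: complex^2^2 \<Rightarrow> complex^2^2)"
proof -
  have comp: "continuous_on SL2 (\<lambda>g. mat2 (a g) (b g) (c g) (d g))"
    if "continuous_on SL2 a" "continuous_on SL2 b" "continuous_on SL2 c" "continuous_on SL2 d" for a b c d
  proof -
    have "(\<lambda>g. mat2 (a g) (b g) (c g) (d g)) =
        (\<lambda>g. \<chi> i j. if i = 1 then if j = 1 then a g else b g else if j = 1 then c g else d g)"
      by (auto simp: fun_eq_iff vec_eq_iff forall_2)
    moreover have "continuous_on SL2 (\<lambda>g. \<chi> i j. if i = (1::2) then if j = (1::2) then a g else b g
        else if j = 1 then c g else d g)"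
    proof (intro continuous_on_vec_lambda)
      show "continuous_on SL2 (\<lambda>g. if i = 1 then if j = 1 then a g else b g else if j = 1 then c g else d g)"
        for i j :: 2
        by (cases "i = 1"; cases "j = 1") (simp_all add: that)
    qed
    ultimately show ?thesis by (simp only:)
  qed
  have "continuous_on SL2 (\<lambda>g. mat2 (g $ 2 $ 2) (- g $ 1 $ 2) (- g $ 2 $ 1) (g $ 1 $ 1))"
    by (intro comp continuous_intros)
  moreover have "matrix_inv g = mat2 (g $ 2 $ 2) (- g $ 1 $ 2) (- g $ 2 $ 1) (g $ 1 $ 1)" if "g \<in> SL2" for g
    using that by (elim SL2_cases) (simp add: matrix_inv_mat2)
  ultimately show ?thesis by (simp cong: continuous_on_cong)
qed

abbreviation torus :: "complex \<Rightarrow> complex^2^2" where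
  "torus t \<equiv> mat2 t 0 0 (1 / t)"

abbreviation upper :: "complex \<Rightarrow> complex^2^2" where
  "upper s \<equiv> mat2 1 s 0 1"

abbreviation lower :: "complex \<Rightarrow> complex^2^2" where
  "lower s \<equiv> mat2 1 0 s 1"

text \<open>If the lower left entry is nonzero, the matrix is a product upper, lower, upper of
  unipotents. Otherwise adding the first row to the second makes this entry nonzero.\<close>

lemma SL2_elementary_induct [consumes 1, case_names upper lower mult]:
  assumes "g \<in> SL2"
    and up: "\<And>s. P (upper s)" and low: "\<And>s. P (lower s)"
    and mult: "\<And>g h. g \<in> SL2 \<Longrightarrow> h \<in> SL2 \<Longrightarrow> P g \<Longrightarrow> P h \<Longrightarrow> P (g ** h)"
  shows "P g"
proof -
  have gen: "P (mat2 a b c d)" if "a * d - b * c = 1" "c \<noteq> 0" for a b c d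
  proof -
    have "a * d - 1 = b * c" using that(1) by (simp add: algebra_simps)
    then have "mat2 a b c d = upper ((a - 1) / c) ** lower c ** upper ((d - 1) / c)"
      using that(2) by (simp add: mat2_mult mat2_eq_iff field_simps)
    then show ?thesis by (simp add: mult up low)
  qed
  obtain a b c d where g: "g = mat2 a b c d" "a * d - b * c = 1" using assms(1) by (rule SL2_cases)
  show ?thesis
  proof (cases "c = 0")
    case True
    then have "a \<noteq> 0" using g(2) by auto
    then have "P (mat2 a b a (b + d))" using g(2) True by (intro gen) (simp_all add: algebra_simps)
    moreover have "g = lower (- 1) ** mat2 a b a (b + d)" using g(1) True by (simp add: mat2_mult mat2_eq_iff)
    ultimately show ?thesis using g True by (simp add: mult low algebra_simps)
  qed (simp add: g gen)
qed

text \<open>Conjugation by \<open>torus 2\<close> multiplies the parameter by \<open>4\<close>, so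
  the commutator with \<open>upper (s / 3)\<close> has parameter
  \<open>4 * s / 3 - s / 3 = s\<close>.\<close>

lemma upper_eq_commutator: "upper s = torus 2 ** upper (s / 3) ** torus (1 / 2) ** upper (- s / 3)"
  by (simp add: mat2_mult mat2_eq_iff)

lemma lower_eq_commutator: "lower s = torus (1 / 2) ** lower (s / 3) ** torus 2 ** lower (- s / 3)"
  by (simp add: mat2_mult mat2_eq_iff)

text \<open>The group is generated by unipotents that are commutators, and a character is trivial on
  commutators.\<close>

lemma SL2_character_trivial:
  fixes ch :: "complex^2^2 \<Rightarrow> complex"
  assumes "g \<in> SL2" and nz: "\<And>g. g \<in> SL2 \<Longrightarrow> ch g \<noteq> 0"
    and mult: "\<And>g h. g \<in> SL2 \<Longrightarrow> h \<in> SL2 \<Longrightarrow> ch (g ** h) = ch g * ch h"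
  shows "ch g = 1"
proof -
  have one: "ch (mat2 1 0 0 1) = 1"
    using mult[of "mat2 1 0 0 1" "mat2 1 0 0 1"] nz[of "mat2 1 0 0 1"] by (simp add: mat2_mult)
  have tor: "ch (torus 2) * ch (torus (1 / 2)) = 1"
    using mult[of "torus 2" "torus (1 / 2)"] one by (simp add: mat2_mult)
  show ?thesis using assms(1)
  proof (induction rule: SL2_elementary_induct)
    case (upper s)
    have "ch (mat2 1 (s / 3) 0 1) * ch (mat2 1 (- s / 3) 0 1) = 1"
      using mult[of "mat2 1 (s / 3) 0 1" "mat2 1 (- s / 3) 0 1"] one by (simp add: mat2_mult)
    then show ?case by (subst upper_eq_commutator) (use tor in \<open>simp add: mult algebra_simps\<close>)
  next
    case (lower s)
    have "ch (mat2 1 0 (s / 3) 1) * ch (mat2 1 0 (- s / 3) 1) = 1"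
      using mult[of "mat2 1 0 (s / 3) 1" "mat2 1 0 (- s / 3) 1"] one by (simp add: mat2_mult)
    then show ?case by (subst lower_eq_commutator) (use tor in \<open>simp add: mult algebra_simps\<close>)
  next
    case (mult g h)
    then show ?case by (simp add: assms(3))
  qed
qed

section \<open>Row \<open>0\<close> of a representation with decreasing weights consists of
  monomials\<close>

section \<open>Representations in weight coordinates\<close>

lemma LIMSEQ_inverse_of_nat_complex: "(\<lambda>k. inverse (of_nat (Suc k)) :: complex) \<longlonglongrightarrow> 0"
  using tendsto_of_real[OF LIMSEQ_inverse_real_of_nat, where 'a = complex] by simp

text \<open>Matrix entries in a basis of weight vectors with decreasing weights. Of algebraicity
  only continuity is kept. Working with entries puts modules and dual modules on the same
  footing.\<close>

locale weight_rep =
  fixes n :: nat and a :: "nat \<Rightarrow> int" and R :: "complex^2^2 \<Rightarrow> nat \<Rightarrow> nat \<Rightarrow> complex"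
  assumes R_mult: "g \<in> SL2 \<Longrightarrow> h \<in> SL2 \<Longrightarrow> i \<le> n \<Longrightarrow> j \<le> n \<Longrightarrow>
      R (g ** h) i j = (\<Sum>k\<le>n. R g i k * R h k j)"
    and R_torus: "t \<noteq> 0 \<Longrightarrow> i \<le> n \<Longrightarrow> j \<le> n \<Longrightarrow>
      R (torus t) i j = (if i = j then t powi a i else 0)"
    and antimono: "i \<le> j \<Longrightarrow> j \<le> n \<Longrightarrow> a j \<le> a i"
    and R_cont: "i \<le> n \<Longrightarrow> j \<le> n \<Longrightarrow> continuous_on SL2 (\<lambda>g. R g i j)"
begin

lemma R_one: "i \<le> n \<Longrightarrow> j \<le> n \<Longrightarrow> R (mat2 1 0 0 1) i j = (if i = j then 1 else 0)"
  using R_torus[of 1 i j] by simp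

lemma torus_mult:
  assumes "t \<noteq> 0" "g \<in> SL2" "i \<le> n" "j \<le> n"
  shows "R (torus t ** g) i j = t powi a i * R g i j"
proof -
  have SL: "torus t \<in> SL2" "g \<in> SL2" "i \<le> n" "j \<le> n" using assms by auto
  have "R (torus t ** g) i j = (\<Sum>k\<le>n. (if k = i then t powi a i * R g i j else 0))"
    unfolding R_mult[OF SL] using assms by (intro sum.cong) (auto simp: R_torus)
  then show ?thesis using assms by simp
qed

lemma mult_torus:
  assumes "t \<noteq> 0" "g \<in> SL2" "i \<le> n" "j \<le> n"
  shows "R (g ** torus t) i j = R g i j * t powi a j"
proof -
  have SL: "g \<in> SL2" "torus t \<in> SL2" "i \<le> n" "j \<le> n" using assms by auto
  have "R (g ** torus t) i j = (\<Sum>k\<le>n. (if k = j then R g i j * t powi a j else 0))"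
    unfolding R_mult[OF SL] using assms by (intro sum.cong) (auto simp: R_torus)
  then show ?thesis using assms by simp
qed

lemma R_tendsto:
  assumes "i \<le> n" "j \<le> n" "\<And>k. p k \<in> SL2" "p \<longlonglongrightarrow> g" "g \<in> SL2"
  shows "(\<lambda>k::nat. R (p k) i j) \<longlonglongrightarrow> R g i j"
  using continuous_on_tendsto_compose[OF R_cont[OF assms(1,2)] assms(4,5)] assms(3) by simp

text \<open>The torus contracts a lower unipotent to \<open>1\<close>, while the weight \<open>a 0\<close> is maximal.\<close>

lemma lower_first_row:
  assumes "j \<le> n"
  shows "R (lower s) 0 j = (if j = 0 then 1 else 0)"
proof -
  \<comment> \<open>These are the conjugates of \<open>lower s\<close> by the torus element at
    \<open>k + 1\<close>. Conjugation multiplies entry \<open>(0, j)\<close> by a nonnegative power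
    of \<open>k + 1\<close>, so an entry whose limit is \<open>0\<close> was \<open>0\<close> from
    the start.\<close>
  define p where "p = (\<lambda>k::nat. lower (s * inverse (of_nat (Suc k)) ^ 2))"
  have "p \<longlonglongrightarrow> lower (s * 0 ^ 2)"
  proof (rule vec_tendstoI)+
    fix i j :: 2
    have lim: "(\<lambda>k. s * inverse (of_nat (Suc k)) ^ 2) \<longlonglongrightarrow> s * 0 ^ 2"
      by (intro tendsto_intros LIMSEQ_inverse_of_nat_complex)
    show "(\<lambda>k. p k $ i $ j) \<longlonglongrightarrow> lower (s * 0 ^ 2) $ i $ j"
      using exhaust_2[of i] exhaust_2[of j] lim by (auto simp: p_def)
  qed
  then have lim: "(\<lambda>k. R (p k) 0 j) \<longlonglongrightarrow> (if j = 0 then 1 else 0)"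
    using R_tendsto[of 0 j p "lower 0"] assms R_one[of 0 j] by (auto simp: p_def)
  have p: "R (p k) 0 j = of_nat (Suc k) powi (a 0 - a j) * R (lower s) 0 j" for k
  proof -
    let ?t = "of_nat (Suc k) :: complex"
    have t: "?t \<noteq> 0" by (simp del: of_nat_Suc)
    have "p k = torus ?t ** lower s ** torus (1 / ?t)"
      using t by (simp add: p_def mat2_mult mat2_eq_iff field_simps power2_eq_square del: of_nat_Suc)
    then have "R (p k) 0 j = R (torus ?t ** lower s) 0 j * (1 / ?t) powi a j"
      using t assms by (simp only:) (intro mult_torus mult_in_SL2, simp_all del: of_nat_Suc)
    also have "R (torus ?t ** lower s) 0 j = ?t powi a 0 * R (lower s) 0 j"
      using t assms by (intro torus_mult) simp_all
    finally have "R (p k) 0 j = ?t powi a 0 * R (lower s) 0 j * (1 / ?t) powi a j" .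
    then show ?thesis using t by (simp add: power_int_diff power_int_divide_distrib del: of_nat_Suc)
  qed
  have "cmod (R (lower s) 0 j) \<le> cmod (R (p k) 0 j)" for k
  proof -
    have "1 \<le> real (Suc k) powi (a 0 - a j)"
      using antimono[of 0 j] assms by (intro one_le_power_int) auto
    then have "1 \<le> cmod (of_nat (Suc k) powi (a 0 - a j))" by (simp add: norm_power_int del: of_nat_Suc)
    then show ?thesis unfolding p norm_mult using mult_right_mono[of 1 _ "cmod (R (lower s) 0 j)"] by simp
  qed
  then have le: "cmod (R (lower s) 0 j) \<le> cmod (if j = 0 then 1 else 0)"
    by (intro LIMSEQ_le_const[OF tendsto_norm[OF lim]]) auto
  show ?thesis
  proof (cases "j = 0")
    case True
    then have "(\<lambda>k. R (lower s) 0 j) \<longlonglongrightarrow> 1" using lim p by simp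
    then show ?thesis using True by (simp add: LIMSEQ_const_iff)
  next
    case False
    then show ?thesis using le by simp
  qed
qed

lemma lower_mult_first_row:
  assumes "g \<in> SL2" "j \<le> n"
  shows "R (lower s ** g) 0 j = R g 0 j"
proof -
  have SL: "lower s \<in> SL2" "g \<in> SL2" "0 \<le> n" "j \<le> n" using assms by auto
  have "R (lower s ** g) 0 j = (\<Sum>k\<le>n. if k = 0 then R g 0 j else 0)"
    unfolding R_mult[OF SL] by (intro sum.cong) (auto simp: lower_first_row)
  then show ?thesis by simp
qed

text \<open>Matrices of determinant one with the same first row differ by a lower unipotent factor
  on the left, and this factor does not change row \<open>0\<close>.\<close>

lemma first_row_cong:
  assumes "g \<in> SL2" "h \<in> SL2" "g $ 1 = h $ 1" "j \<le> n"
  shows "R g 0 j = R h 0 j"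
proof -
  obtain x y c d where g: "g = mat2 x y c d" "x * d - y * c = 1" using assms(1) by (rule SL2_cases)
  obtain x' y' c' d' where h: "h = mat2 x' y' c' d'" "x' * d' - y' * c' = 1" using assms(2) by (rule SL2_cases)
  have eq: "x' = x" "y' = y" using assms(3) g(1) h(1) by (metis mat2_nth(1), metis mat2_nth(2))
  have "c + (c' * d - d' * c) * x = c'" "d + (c' * d - d' * c) * y = d'"
    using g(2) h(2) unfolding eq by algebra+
  then have "h = lower (c' * d - d' * c) ** g"
    by (simp add: g h eq mat2_mult mat2_eq_iff add.commute)
  then show ?thesis using lower_mult_first_row[OF assms(1,4)] by simp
qed

text \<open>The names anticipate \<open>first_row\<close>: entry \<open>(0, j)\<close> is
  \<open>\<kappa> j\<close> times the monomial of degree \<open>N\<close> with exponent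
  \<open>ex j\<close> in the second variable. By \<open>weight_eq\<close>, truncation in
  \<open>nat\<close> and \<open>div\<close> loses nothing when \<open>\<kappa> j\<close> is
  nonzero.\<close>

definition N :: nat where "N = nat (a 0)"

definition \<kappa> :: "nat \<Rightarrow> complex" where "\<kappa> j = R (upper 1) 0 j"

definition ex :: "nat \<Rightarrow> nat" where "ex j = nat ((a 0 - a j) div 2)"

text \<open>The row \<open>(x, y)\<close> is the first row of
  \<open>torus s ** upper 1 ** torus (x / s)\<close>, and the torus factors act through weights.
  Either square root of \<open>x * y\<close> may serve as \<open>s\<close>.\<close>

lemma first_row_generic:
  assumes "mat2 x y c d \<in> SL2" "x \<noteq> 0" "y \<noteq> 0" "j \<le> n" "s\<^sup>2 = x * y"
  shows "R (mat2 x y c d) 0 j = \<kappa> j * x powi a j * s powi (a 0 - a j)"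
proof -
  have s: "s \<noteq> 0" using assms by auto
  have xs: "x / s \<noteq> 0" using s assms by simp
  have "torus s ** upper 1 ** torus (x / s) = mat2 x (s * (s / x)) 0 (1 / x)"
    using s assms(2) by (simp add: mat2_mult mat2_eq_iff field_simps)
  also have "s * (s / x) = y" using assms by (simp add: power2_eq_square)
  finally have *: "torus s ** upper 1 ** torus (x / s) = mat2 x y 0 (1 / x)" .
  have "R (mat2 x y c d) 0 j = R (mat2 x y 0 (1 / x)) 0 j"
    using assms by (intro first_row_cong) (auto simp: vec_eq_iff forall_2)
  also have "\<dots> = R (torus s ** upper 1) 0 j * (x / s) powi a j"
    unfolding *[symmetric] using s assms(4) by (intro mult_torus xs mult_in_SL2) simp_all
  also have "R (torus s ** upper 1) 0 j = s powi a 0 * \<kappa> j"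
    unfolding \<kappa>_def using s assms(4) by (intro torus_mult) simp_all
  also have "s powi a 0 * \<kappa> j * (x / s) powi a j = s powi a 0 * \<kappa> j * (x powi a j / s powi a j)"
    by (simp add: power_int_divide_distrib)
  also have "\<dots> = \<kappa> j * x powi a j * s powi (a 0 - a j)"
    using s by (simp add: power_int_diff power_int_divide_distrib)
  finally show ?thesis .
qed

lemma weight_eq:
  assumes "j \<le> n" "\<kappa> j \<noteq> 0"
  shows "a j = a 0 - 2 * int (ex j)" and "0 \<le> a 0 - int (ex j)"
proof -
  \<comment> \<open>Choosing the square root \<open>- 1\<close> of \<open>1 * 1\<close> must give
    the same value as the root \<open>1\<close>.\<close>
  have "\<kappa> j = \<kappa> j * (- 1) powi (a 0 - a j)"
    using first_row_generic[of 1 1 0 1 j "- 1"] assms(1) by (simp add: \<kappa>_def)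
  then have "even (a 0 - a j)"
    using assms(2) by (cases "even (a 0 - a j)") (auto simp: power_int_minus_left)
  then show aj: "a j = a 0 - 2 * int (ex j)"
    using antimono[of 0 j] assms(1) by (auto simp: ex_def)
  show "0 \<le> a 0 - int (ex j)"
  proof (rule ccontr)
    assume neg: "\<not> ?thesis"
    \<comment> \<open>Along the rows \<open>(x, 1)\<close> with \<open>x\<close> tending to
      \<open>0\<close>, the entry is \<open>\<kappa> j\<close> times \<open>x\<close> to the power
      \<open>a 0 - ex j\<close>. Continuity at \<open>(0, 1)\<close> keeps it bounded, which
      excludes a negative exponent.\<close>
    define p where "p = (\<lambda>k::nat. mat2 (inverse (of_nat (Suc k))) 1 (- 1) 0)"
    have "p \<longlonglongrightarrow> mat2 0 1 (- 1) 0"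
    proof (rule vec_tendstoI)+
      fix i j :: 2
      show "(\<lambda>k. p k $ i $ j) \<longlonglongrightarrow> mat2 0 1 (- 1) 0 $ i $ j"
        using exhaust_2[of i] exhaust_2[of j] LIMSEQ_inverse_of_nat_complex by (auto simp: p_def)
    qed
    then have "(\<lambda>k. R (p k) 0 j) \<longlonglongrightarrow> R (mat2 0 1 (- 1) 0) 0 j"
      using assms by (intro R_tendsto) (auto simp: p_def)
    then have "Bseq (\<lambda>k. R (p k) 0 j)" by (intro convergent_imp_Bseq convergentI)
    then obtain K where K: "K > 0" "\<And>k. cmod (R (p k) 0 j) \<le> K" unfolding Bseq_def by auto
    have "real (Suc k) * cmod (\<kappa> j) \<le> K" for k
    proof -
      let ?x = "inverse (of_nat (Suc k)) :: complex"
      have x: "?x \<noteq> 0" by (simp del: of_nat_Suc)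
      obtain s where s: "s\<^sup>2 = ?x * 1" using power2_csqrt by blast
      have "R (p k) 0 j = \<kappa> j * ?x powi a j * s powi (2 * int (ex j))"
        unfolding p_def using assms(1) aj x s by (subst first_row_generic) auto
      also have "s powi (2 * int (ex j)) = ?x powi int (ex j)"
        using s by (simp add: power_int_mult del: of_nat_Suc)
      also have "\<kappa> j * ?x powi a j * ?x powi int (ex j) = \<kappa> j * ?x powi (a 0 - int (ex j))"
      proof -
        have e: "a 0 - int (ex j) = a j + int (ex j)" using aj by simp
        show ?thesis unfolding e using x by (simp add: power_int_add del: of_nat_Suc)
      qed
      finally have "cmod (R (p k) 0 j) = cmod (\<kappa> j) * real (Suc k) powi (int (ex j) - a 0)"
        by (simp add: norm_mult norm_power_int norm_inverse power_int_inverse power_int_minus[symmetric] del: of_nat_Suc)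
      moreover have "real (Suc k) powi 1 \<le> real (Suc k) powi (int (ex j) - a 0)"
        using neg by (intro power_int_increasing) auto
      ultimately show ?thesis using K(2)[of k]
        by (smt (verit) mult.commute mult_left_mono norm_ge_zero power_int_1_right)
    qed
    moreover obtain k :: nat where "real k * cmod (\<kappa> j) > K"
      using assms(2) reals_Archimedean3[of "cmod (\<kappa> j)"] by auto
    ultimately show False using assms(2)
      by (smt (verit) mult_right_mono norm_ge_zero of_nat_Suc)
  qed
qed

text \<open>With weight difference \<open>0\<close> the entry \<open>(0, 0)\<close> is constant on
  the nontrivial upper unipotents, which approach the identity.\<close>

lemma \<kappa>_0: "\<kappa> 0 = 1"
proof -
  define p where "p = (\<lambda>k::nat. upper (inverse (of_nat (Suc k))))"
  have "p \<longlonglongrightarrow> upper 0"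
  proof (rule vec_tendstoI)+
    fix i j :: 2
    show "(\<lambda>k. p k $ i $ j) \<longlonglongrightarrow> upper 0 $ i $ j"
      using exhaust_2[of i] exhaust_2[of j] LIMSEQ_inverse_of_nat_complex by (auto simp: p_def)
  qed
  then have "(\<lambda>k. R (p k) 0 0) \<longlonglongrightarrow> R (upper 0) 0 0"
    by (intro R_tendsto) (auto simp: p_def)
  moreover have "R (p k) 0 0 = \<kappa> 0" for k
  proof -
    obtain s :: complex where "s\<^sup>2 = 1 * inverse (of_nat (Suc k))" using power2_csqrt by blast
    then show ?thesis unfolding p_def by (subst first_row_generic) (auto simp del: of_nat_Suc)
  qed
  ultimately show ?thesis using R_one[of 0 0] by (simp add: LIMSEQ_const_iff)
qed

lemma a0: "a 0 = int N"
  using weight_eq(2)[of 0] by (simp add: \<kappa>_0 N_def ex_def)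

lemma ex_le_N: "j \<le> n \<Longrightarrow> \<kappa> j \<noteq> 0 \<Longrightarrow> ex j \<le> N"
  using weight_eq(2)[of j] by (simp add: a0)

text \<open>Inserting the weights into the generic formula removes the square root. The rows with a
  zero entry are reached by limits within the group.\<close>

lemma first_row:
  assumes "g \<in> SL2" "j \<le> n"
  shows "R g 0 j = \<kappa> j * ((g $ 1 $ 1) ^ (N - ex j) * (g $ 1 $ 2) ^ ex j)"
proof -
  have gen: "R (mat2 x y c d) 0 j = \<kappa> j * (x ^ (N - ex j) * y ^ ex j)"
    if "x * d - y * c = 1" "x \<noteq> 0" "y \<noteq> 0" for x y c d
  proof (cases "\<kappa> j = 0")
    case True
    then show ?thesis using that assms first_row_generic[of x y c d j "csqrt (x * y)"] by simp
  next
    case False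
    have "R (mat2 x y c d) 0 j = \<kappa> j * x powi a j * csqrt (x * y) powi (2 * int (ex j))"
      using that assms False weight_eq(1)[of j] by (subst first_row_generic[of _ _ _ _ _ "csqrt (x * y)"]) auto
    also have "csqrt (x * y) powi (2 * int (ex j)) = (x * y) powi int (ex j)"
      by (simp add: power_int_mult)
    also have "\<kappa> j * x powi a j * (x * y) powi int (ex j) = \<kappa> j * (x powi (a j + int (ex j)) * y powi int (ex j))"
      using that by (simp add: power_int_add power_int_mult_distrib power_mult_distrib mult_ac)
    also have "a j + int (ex j) = int (N - ex j)"
      using weight_eq(1)[of j] ex_le_N[of j] assms False by (simp add: a0 of_nat_diff)
    finally show ?thesis by simp
  qed
  obtain x y c d where g: "g = mat2 x y c d" "x * d - y * c = 1" using assms(1) by (rule SL2_cases)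
  have lim: "R g 0 j = \<kappa> j * (x ^ (N - ex j) * y ^ ex j)"
    if X: "X \<longlonglongrightarrow> x" and Y: "Y \<longlonglongrightarrow> y" and C: "C \<longlonglongrightarrow> c" and D: "D \<longlonglongrightarrow> d"
      and nz: "\<And>k::nat. X k * D k - Y k * C k = 1 \<and> X k \<noteq> 0 \<and> Y k \<noteq> 0" for X Y C D
  proof -
    have "(\<lambda>k. mat2 (X k) (Y k) (C k) (D k)) \<longlonglongrightarrow> g"
    proof (rule vec_tendstoI)+
      fix i j :: 2
      show "(\<lambda>k. mat2 (X k) (Y k) (C k) (D k) $ i $ j) \<longlonglongrightarrow> g $ i $ j"
        using exhaust_2[of i] exhaust_2[of j] X Y C D by (auto simp: g(1))
    qed
    then have "(\<lambda>k. R (mat2 (X k) (Y k) (C k) (D k)) 0 j) \<longlonglongrightarrow> R g 0 j"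
      using assms nz by (intro R_tendsto) auto
    moreover have "(\<lambda>k. \<kappa> j * (X k ^ (N - ex j) * Y k ^ ex j)) \<longlonglongrightarrow> \<kappa> j * (x ^ (N - ex j) * y ^ ex j)"
      by (intro tendsto_intros X Y)
    ultimately show ?thesis using nz gen LIMSEQ_unique by simp
  qed
  have inv: "(\<lambda>k. inverse (of_nat (Suc k)) :: complex) \<longlonglongrightarrow> 0" by (rule LIMSEQ_inverse_of_nat_complex)
  consider "x \<noteq> 0" "y \<noteq> 0" | "y = 0" "x \<noteq> 0" | "x = 0" "y \<noteq> 0" using g(2) by fastforce
  then have "R g 0 j = \<kappa> j * (x ^ (N - ex j) * y ^ ex j)"
  proof cases
    case 1
    then show ?thesis using gen g by simp
  next
    case 2
    \<comment> \<open>The zero entry \<open>y\<close> is replaced by \<open>1 / (k + 1)\<close>, and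
      this change of \<open>d\<close> keeps the determinant equal to one.\<close>
    have "(\<lambda>k. d + inverse (of_nat (Suc k)) * c / x) \<longlonglongrightarrow> d + 0 * c / x"
      using 2 by (intro tendsto_intros inv) auto
    then show ?thesis
      using 2 g(2) by (intro lim[of "\<lambda>_. x" "\<lambda>k. inverse (of_nat (Suc k))" "\<lambda>_. c" "\<lambda>k. d + inverse (of_nat (Suc k)) * c / x"])
          (use inv in \<open>auto simp del: of_nat_Suc simp: field_simps\<close>)
  next
    case 3
    have "(\<lambda>k. c + inverse (of_nat (Suc k)) * d / y) \<longlonglongrightarrow> c + 0 * d / y"
      using 3 by (intro tendsto_intros inv) auto
    then show ?thesis
      using 3 g(2) by (intro lim[of "\<lambda>k. inverse (of_nat (Suc k))" "\<lambda>_. y" "\<lambda>k. c + inverse (of_nat (Suc k)) * d / y" "\<lambda>_. d"])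
          (use inv in \<open>auto simp del: of_nat_Suc simp: field_simps\<close>)
  qed
  then show ?thesis by (simp add: g(1))
qed

end

text \<open>Powers of \<open>2\<close> differ in absolute value, so the single element
  \<open>torus 2\<close> separates all weights.\<close>

lemma two_powi_inject: "(2::complex) powi i = 2 powi j \<Longrightarrow> i = j"
proof -
  have less: "(2::real) powi i < 2 powi j" if "i < j" for i j
    using that by (intro power_int_strict_increasing) auto
  assume "(2::complex) powi i = 2 powi j"
  then have "cmod (2 powi i) = cmod (2 powi j)" by simp
  then have "(2::real) powi i = 2 powi j" by (simp add: norm_power_int)
  then show "i = j" using less[of i j] less[of j i] by (cases i j rule: linorder_cases) auto
qed

context weight_rep
begin

lemma ex_0: "ex 0 = 0"
  by (simp add: ex_def)

text \<open>All monomials of degree \<open>N\<close> occur in \<open>(x + y) ^ N\<close>, which is a translate of the first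
  row entry \<open>x ^ N\<close>.\<close>

lemma monomial_occurs:
  assumes "k \<le> N"
  obtains j where "j \<le> n" "\<kappa> j \<noteq> 0" "ex j = k"
proof -
  have "\<exists>j\<le>n. \<kappa> j \<noteq> 0 \<and> ex j = k"
  proof (rule ccontr)
    assume none: "\<not> ?thesis"
    let ?c = "\<lambda>j. R (lower 1) j 0"
    have "(1 + y) ^ N = (\<Sum>j\<le>n. \<kappa> j * y ^ ex j * ?c j)" for y
    proof -
      \<comment> \<open>Its first row is \<open>(1 + y, y)\<close>. Expanding through row
        \<open>0\<close> of \<open>upper y\<close>, where \<open>x = 1\<close>, writes
        \<open>(1 + y) ^ N\<close> as a combination of the powers \<open>y ^ ex j\<close>.\<close>
      have "upper y ** lower 1 = mat2 (1 + y) y 1 1" by (simp add: mat2_mult mat2_eq_iff)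
      then have "(1 + y) ^ N = R (upper y ** lower 1) 0 0"
        by (simp add: first_row \<kappa>_0 ex_0)
      also have "\<dots> = (\<Sum>j\<le>n. R (upper y) 0 j * ?c j)" by (intro R_mult) auto
      also have "\<dots> = (\<Sum>j\<le>n. \<kappa> j * y ^ ex j * ?c j)"
        by (intro sum.cong) (auto simp: first_row)
      finally show ?thesis .
    qed
    then have "poly ([:1, 1:] ^ N) y = poly (\<Sum>j\<le>n. monom (\<kappa> j * ?c j) (ex j)) y" for y
      by (simp add: poly_sum poly_monom mult_ac)
    then have "[:1, 1:] ^ N = (\<Sum>j\<le>n. monom (\<kappa> j * ?c j) (ex j))"
      by (simp add: poly_eq_poly_eq_iff[symmetric] fun_eq_iff)
    then have "coeff ([:1, 1 :: complex:] ^ N) k = (\<Sum>j\<le>n. if ex j = k then \<kappa> j * ?c j else 0)"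
      by (simp add: coeff_sum)
    also have "\<dots> = 0" using none by (intro sum.neutral) auto
    finally show False using assms by (simp add: coeff_linear_poly_power)
  qed
  then show ?thesis using that by blast
qed

text \<open>The Weyl element inverts the torus by conjugation, so it negates weights:
  \<open>- a n\<close> is itself a weight and hence at most \<open>a 0\<close>.\<close>

lemma weight_lower_bound: "- a 0 \<le> a n"
proof -
  let ?w = "mat2 0 1 (- 1) 0" and ?w' = "mat2 0 (- 1) 1 0"
  have "R (?w' ** ?w) n n = (\<Sum>k\<le>n. R ?w' n k * R ?w k n)" by (intro R_mult) auto
  moreover have "?w' ** ?w = mat2 1 0 0 1" by (simp add: mat2_mult)
  ultimately have "(\<Sum>k\<le>n. R ?w' n k * R ?w k n) \<noteq> 0" by (simp add: R_one)
  then obtain i where i: "i \<le> n" "R ?w i n \<noteq> 0"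
    by (metis (no_types, lifting) atMost_iff mult_zero_right sum.neutral)
  have "?w ** torus 2 = torus (1 / 2) ** ?w" by (simp add: mat2_mult mat2_eq_iff)
  then have "R ?w i n * 2 powi a n = (1 / 2) powi a i * R ?w i n"
    using i(1) mult_torus[of 2 ?w i n] torus_mult[of "1 / 2" ?w i n] by simp
  then have "2 powi a n = (2::complex) powi (- a i)"
    using i(2) by (simp add: power_int_divide_distrib power_int_minus field_simps)
  then have "a n = - a i" by (rule two_powi_inject)
  then show ?thesis using antimono[of 0 i] i(1) by simp
qed

text \<open>All weights lie between \<open>- a 0\<close> and \<open>a 0\<close>, so the torus acts
  trivially, and with it the unipotents, which are commutators with torus elements.\<close>

lemma trivial_if_weights_0:
  assumes "N = 0" "g \<in> SL2" "i \<le> n" "j \<le> n"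
  shows "R g i j = (if i = j then 1 else 0)"
proof -
  have a: "a i = 0" if "i \<le> n" for i
    using weight_lower_bound antimono[of 0 i] antimono[of i n] that assms(1) a0 by simp
  have comm: "R (torus t ** u ** torus t' ** u') i j = (if i = j then 1 else 0)"
    if "t \<noteq> 0" "t' \<noteq> 0" "u \<in> SL2" "u' \<in> SL2" "u ** u' = mat2 1 0 0 1" "i \<le> n" "j \<le> n" for t t' u u' i j
  proof -
    have tor: "torus t \<in> SL2" "torus t' \<in> SL2" using that by simp_all
    have "R (torus t ** u ** torus t' ** u') i j = (\<Sum>k\<le>n. R (torus t ** u ** torus t') i k * R u' k j)"
      using that tor by (intro R_mult mult_in_SL2)
    also have "\<dots> = (\<Sum>k\<le>n. R u i k * R u' k j)"
      using that tor by (intro sum.cong) (simp_all add: mult_torus torus_mult a)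
    also have "\<dots> = R (u ** u') i j" using that by (intro R_mult[symmetric])
    finally show ?thesis using that by (simp add: R_one)
  qed
  show ?thesis using assms(2-4)
  proof (induction arbitrary: i j rule: SL2_elementary_induct)
    case (upper s)
    show ?case
      by (subst upper_eq_commutator, rule comm) (use upper in \<open>simp_all add: mat2_mult\<close>)
  next
    case (lower s)
    show ?case
      by (subst lower_eq_commutator, rule comm) (use lower in \<open>simp_all add: mat2_mult\<close>)
  next
    case (mult g h)
    have "R (g ** h) i j = (\<Sum>k\<le>n. if k = i then (if i = j then 1 else 0) else 0)"
      unfolding R_mult[OF mult.hyps mult.prems] using mult.prems by (intro sum.cong) (auto simp: mult.IH)
    then show ?case using mult.prems by simp
  qed
qed

end

section \<open>The weights of the three modules in boundary format\<close>

locale irreducible_weight_rep = weight_rep +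
  assumes weights: "i \<le> n \<Longrightarrow> a i = a 0 - 2 * int i" and n_pos: "1 \<le> n"
begin

lemma ex_eq: "i \<le> n \<Longrightarrow> ex i = i"
  using weights[of i] by (simp add: ex_def)

text \<open>Only the step of the weights is assumed. The symmetry of the weights gives one
  inequality; the other holds because exponent \<open>N\<close> must occur among the indices up to
  \<open>n\<close>.\<close>

lemma N_eq: "N = n"
proof -
  have "n \<le> N" using weight_lower_bound weights[of n] a0 by simp
  moreover have "N \<le> n"
  proof -
    obtain j where "j \<le> n" "ex j = N" using monomial_occurs[of N] by blast
    then show ?thesis using ex_eq by simp
  qed
  ultimately show ?thesis by simp
qed

lemma \<kappa>_nonzero:
  assumes "i \<le> n"
  shows "\<kappa> i \<noteq> 0"
proof -
  obtain j where "j \<le> n" "\<kappa> j \<noteq> 0" "ex j = i" using monomial_occurs[of i] assms N_eq by auto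
  then show ?thesis using ex_eq by simp
qed

end

text \<open>\<open>D\<close> stands for the dual of \<open>C\<close>, and \<open>T i j l\<close> is
  coordinate \<open>l\<close> of the product of basis vectors \<open>i\<close> and \<open>j\<close>.
  In \<open>equivariant\<close>, the group acts on the factors on the left and on the product on the
  right.\<close>

locale boundary_tensor = A: weight_rep n a RA + B: weight_rep m b RB + D: weight_rep "n + m" d RD
  for n m :: nat and a b d RA RB RD +
  fixes T :: "nat \<Rightarrow> nat \<Rightarrow> nat \<Rightarrow> complex"
  assumes equivariant: "g \<in> SL2 \<Longrightarrow> i \<le> n \<Longrightarrow> j \<le> m \<Longrightarrow> l \<le> n + m \<Longrightarrow>
      (\<Sum>i'\<le>n. \<Sum>j'\<le>m. RA g i' i * RB g j' j * T i' j' l) = (\<Sum>l'\<le>n + m. RD g l l' * T i j l')"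
    and nondegenerate: "\<exists>i\<le>n. u i \<noteq> 0 \<Longrightarrow> \<exists>j\<le>m. v j \<noteq> 0 \<Longrightarrow>
      \<exists>l\<le>n + m. (\<Sum>i\<le>n. \<Sum>j\<le>m. u i * v j * T i j l) \<noteq> 0"
    and A_nontrivial: "A.N \<noteq> 0" and B_nontrivial: "B.N \<noteq> 0"
begin

lemma T_weight:
  assumes "i \<le> n" "j \<le> m" "l \<le> n + m" "T i j l \<noteq> 0"
  shows "d l = a i + b j"
proof -
  have "(\<Sum>i'\<le>n. \<Sum>j'\<le>m. RA (torus 2) i' i * RB (torus 2) j' j * T i' j' l)
      = (\<Sum>i'\<le>n. if i' = i then 2 powi a i * 2 powi b j * T i j l else 0)"
  proof (rule sum.cong[OF refl])
    fix i' assume "i' \<in> {..n}"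
    then have "(\<Sum>j'\<le>m. RA (torus 2) i' i * RB (torus 2) j' j * T i' j' l)
        = (\<Sum>j'\<le>m. if j' = j then (if i' = i then 2 powi a i * 2 powi b j * T i j l else 0) else 0)"
      using assms by (intro sum.cong) (auto simp: A.R_torus B.R_torus)
    then show "(\<Sum>j'\<le>m. RA (torus 2) i' i * RB (torus 2) j' j * T i' j' l)
        = (if i' = i then 2 powi a i * 2 powi b j * T i j l else 0)"
      using assms by simp
  qed
  also have "\<dots> = 2 powi (a i + b j) * T i j l" using assms by (simp add: power_int_add)
  finally have "2 powi (a i + b j) * T i j l = (\<Sum>l'\<le>n + m. RD (torus 2) l l' * T i j l')"
    using equivariant[of "torus 2" i j l] assms by simp
  also have "\<dots> = (\<Sum>l'\<le>n + m. if l' = l then 2 powi d l * T i j l else 0)"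
    using assms by (intro sum.cong) (auto simp: D.R_torus)
  also have "\<dots> = 2 powi d l * T i j l" using assms by simp
  finally have "2 powi (a i + b j) = (2::complex) powi d l" using assms by simp
  then show ?thesis using two_powi_inject by metis
qed

text \<open>Hopf's bound for the spans of the basis vectors in \<open>I\<close> and
  \<open>J\<close>. Coefficients are extended by zero, and by \<open>T_weight\<close> the products
  have no coordinates outside \<open>L\<close>.\<close>

lemma card_target:
  assumes "I \<subseteq> {..n}" "J \<subseteq> {..m}" "L \<subseteq> {..n + m}" "I \<noteq> {}" "J \<noteq> {}"
    and L: "\<And>i j l. i \<in> I \<Longrightarrow> j \<in> J \<Longrightarrow> l \<le> n + m \<Longrightarrow> d l = a i + b j \<Longrightarrow> l \<in> L"
  shows "card I + card J \<le> card L + 1"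
proof (rule nondegenerate_bilinear_card[where T = T])
  show "finite I" "finite J" "finite L" using assms(1-3) finite_subset by blast+
  fix u v :: "nat \<Rightarrow> complex"
  assume u: "\<exists>i\<in>I. u i \<noteq> 0" and v: "\<exists>j\<in>J. v j \<noteq> 0"
  define u' v' where "u' = (\<lambda>i. if i \<in> I then u i else 0)" and "v' = (\<lambda>j. if j \<in> J then v j else 0)"
  have sum: "(\<Sum>i\<le>n. \<Sum>j\<le>m. u' i * v' j * T i j l) = (\<Sum>i\<in>I. \<Sum>j\<in>J. u i * v j * T i j l)" for l
  proof -
    have "(\<Sum>i\<le>n. \<Sum>j\<le>m. u' i * v' j * T i j l) = (\<Sum>i\<in>I. \<Sum>j\<le>m. u' i * v' j * T i j l)"
      using assms(1) by (intro sum.mono_neutral_right) (auto simp: u'_def)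
    also have "\<dots> = (\<Sum>i\<in>I. \<Sum>j\<in>J. u' i * v' j * T i j l)"
      using assms(2) by (intro sum.cong sum.mono_neutral_right) (auto simp: v'_def)
    also have "\<dots> = (\<Sum>i\<in>I. \<Sum>j\<in>J. u i * v j * T i j l)"
      by (intro sum.cong) (auto simp: u'_def v'_def)
    finally show ?thesis .
  qed
  have "\<exists>i\<le>n. u' i \<noteq> 0" "\<exists>j\<le>m. v' j \<noteq> 0" using u v assms(1,2) by (auto simp: u'_def v'_def)
  then obtain l where l: "l \<le> n + m" "(\<Sum>i\<in>I. \<Sum>j\<in>J. u i * v j * T i j l) \<noteq> 0"
    using nondegenerate[of u' v'] sum by auto
  then obtain i j where "i \<in> I" "j \<in> J" "T i j l \<noteq> 0"
    by (metis (no_types, lifting) mult_zero_right sum.neutral)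
  then have "l \<in> L" using L[of i j l] T_weight[of i j l] l(1) assms(1,2) by auto
  then show "\<exists>l\<in>L. (\<Sum>i\<in>I. \<Sum>j\<in>J. u i * v j * T i j l) \<noteq> 0" using l(2) by auto
qed (use assms in auto)

text \<open>Each inequality comes from a count that would miss Hopf's bound by one. The final
  segments from \<open>i\<close> and \<open>j\<close> have \<open>n + m - i - j + 2\<close> indices
  in total, against \<open>n + m - i - j\<close> in the target; the initial segments have
  \<open>i + j + 2\<close> against \<open>i + j\<close>.\<close>

lemma weights_add:
  assumes "i \<le> n" "j \<le> m"
  shows "d (i + j) = a i + b j"
proof (rule antisym)
  show "d (i + j) \<le> a i + b j"
  proof (rule ccontr)
    assume less: "\<not> ?thesis"
    have "card {i..n} + card {j..m} \<le> card {i + j + 1..n + m} + 1"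
    proof (rule card_target)
      fix i' j' l assume l: "i' \<in> {i..n}" "j' \<in> {j..m}" "l \<le> n + m" "d l = a i' + b j'"
      then have "d l \<le> a i + b j" using A.antimono[of i i'] B.antimono[of j j'] by auto
      then have "\<not> l \<le> i + j" using less D.antimono[of l "i + j"] assms by auto
      then show "l \<in> {i + j + 1..n + m}" using l by simp
    qed (use assms in auto)
    then show False using assms by simp
  qed
  show "a i + b j \<le> d (i + j)"
  proof (rule ccontr)
    assume less: "\<not> ?thesis"
    have "card {..i} + card {..j} \<le> card {..<i + j} + 1"
    proof (rule card_target)
      fix i' j' l assume l: "i' \<in> {..i}" "j' \<in> {..j}" "l \<le> n + m" "d l = a i' + b j'"
      then have "a i + b j \<le> d l" using A.antimono[of i' i] B.antimono[of j' j] assms by auto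
      then have "\<not> i + j \<le> l" using less D.antimono[of "i + j" l] l by auto
      then show "l \<in> {..<i + j}" by simp
    qed (use assms in auto)
    then show False by simp
  qed
qed

text \<open>A nonzero highest weight makes exponent \<open>1\<close> occur, and index
  \<open>0\<close> carries exponent \<open>0\<close>.\<close>

lemma n_pos: "1 \<le> n" and m_pos: "1 \<le> m"
proof -
  obtain j where "j \<le> n" "A.ex j = 1" using A.monomial_occurs[of 1] A_nontrivial by auto
  then show "1 \<le> n" using A.ex_0 by (cases "j = 0") auto
  obtain j where "j \<le> m" "B.ex j = 1" using B.monomial_occurs[of 1] B_nontrivial by auto
  then show "1 \<le> m" using B.ex_0 by (cases "j = 0") auto
qed

definition \<delta> :: int where "\<delta> = a 0 - a 1"

text \<open>The sum of the weights depends on \<open>i + j\<close> alone, so moving one unit of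
  index from one factor to the other shows that all steps agree.\<close>

lemma progression:
  "i \<le> n \<Longrightarrow> a i = a 0 - \<delta> * int i" "j \<le> m \<Longrightarrow> b j = b 0 - \<delta> * int j"
  "l \<le> n + m \<Longrightarrow> d l = d 0 - \<delta> * int l"
proof -
  have b1: "b 0 - b 1 = \<delta>"
    using weights_add[of 0 1] weights_add[of 1 0] n_pos m_pos by (simp add: \<delta>_def)
  show A: "a i = a 0 - \<delta> * int i" if "i \<le> n" for i
    using that
  proof (induction i)
    case (Suc i)
    have "a i + b 1 = a (Suc i) + b 0"
      using weights_add[of i 1] weights_add[of "Suc i" 0] Suc.prems m_pos by simp
    then show ?case using Suc b1 by (simp add: algebra_simps)
  qed simp
  show B: "b j = b 0 - \<delta> * int j" if "j \<le> m" for j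
    using that
  proof (induction j)
    case (Suc j)
    have "a 1 + b j = a 0 + b (Suc j)"
      using weights_add[of 1 j] weights_add[of 0 "Suc j"] Suc.prems n_pos by simp
    then show ?case using Suc by (simp add: algebra_simps \<delta>_def)
  qed simp
  show "d l = d 0 - \<delta> * int l" if "l \<le> n + m"
  proof -
    define i j where "i = min l n" and "j = l - min l n"
    have "l = i + j" "i \<le> n" "j \<le> m" using that by (auto simp: i_def j_def)
    then show ?thesis using weights_add[of i j] weights_add[of 0 0] A[of i] B[of j] by (simp add: algebra_simps)
  qed
qed

text \<open>Exponent \<open>1\<close> occurs at some index \<open>j\<close>, whose weight is
  \<open>a 0 - 2\<close>; hence \<open>\<delta> * j = 2\<close>.\<close>

lemma \<delta>_cases: "\<delta> = 1 \<or> \<delta> = 2"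
proof -
  obtain j where j: "j \<le> n" "A.\<kappa> j \<noteq> 0" "A.ex j = 1" using A.monomial_occurs[of 1] A_nontrivial by auto
  have "\<delta> * int j = 2" using A.weight_eq(1)[OF j(1,2)] progression(1)[OF j(1)] j(3) by simp
  then have "\<delta> dvd 2" by (metis dvd_triv_left)
  have "\<delta> > 0"
    using \<open>\<delta> * int j = 2\<close> mult_nonpos_nonneg[of \<delta> "int j"] by (cases "\<delta> > 0") auto
  have "\<delta> \<le> 2" using \<open>\<delta> dvd 2\<close> by (intro zdvd_imp_le) auto
  then show ?thesis using \<open>\<delta> > 0\<close> by auto
qed

text \<open>As the step is nonzero, the weights \<open>d\<close> are distinct, so the weight of a
  product of basis vectors fixes its index.\<close>

lemma T_support:
  assumes "i \<le> n" "j \<le> m" "l \<le> n + m" "T i j l \<noteq> 0"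
  shows "l = i + j"
  using T_weight[OF assms] weights_add[OF assms(1,2)] progression(3)[of l] progression(3)[of "i + j"]
    assms \<delta>_cases by auto

lemma T_nonzero:
  assumes "i \<le> n" "j \<le> m"
  shows "T i j (i + j) \<noteq> 0"
proof -
  have "\<exists>l\<le>n + m. (\<Sum>i'\<le>n. \<Sum>j'\<le>m. (if i' = i then 1 else 0) * (if j' = j then 1 else 0) * T i' j' l) \<noteq> 0"
    by (rule nondegenerate) (use assms in auto)
  then obtain l where l: "l \<le> n + m"
      "(\<Sum>i'\<le>n. \<Sum>j'\<le>m. (if i' = i then 1 else 0) * (if j' = j then 1 else 0) * T i' j' l) \<noteq> 0"
    by blast
  then obtain i' j' where "i' \<le> n" "j' \<le> m" "(if i' = i then 1 else 0) * (if j' = j then 1 else 0) * T i' j' l \<noteq> 0"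
    by (metis (no_types, lifting) atMost_iff sum.neutral)
  then have "T i j l \<noteq> 0" by (auto split: if_splits)
  then show ?thesis using T_support assms l(1) by metis
qed

text \<open>Equivariance read at coordinate \<open>0\<close>, to which only the pair
  \<open>(0, 0)\<close> contributes. This is what turns the bilinear map into the product of
  forms.\<close>

lemma first_row_mult:
  assumes "g \<in> SL2" "i \<le> n" "j \<le> m"
  shows "(\<Sum>l\<le>n + m. RD g 0 l * T i j l) = T 0 0 0 * (RA g 0 i * RB g 0 j)"
proof -
  have "(\<Sum>l\<le>n + m. RD g 0 l * T i j l) = (\<Sum>i'\<le>n. \<Sum>j'\<le>m. RA g i' i * RB g j' j * T i' j' 0)"
    using equivariant[of g i j 0] assms by simp
  also have "\<dots> = (\<Sum>i'\<le>n. \<Sum>j'\<le>m. if j' = 0 then (if i' = 0 then RA g 0 i * RB g 0 j * T 0 0 0 else 0) else 0)"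
    using T_support[of _ _ 0] by (intro sum.cong) (force split: if_splits)+
  also have "\<dots> = T 0 0 0 * (RA g 0 i * RB g 0 j)" by simp
  finally show ?thesis .
qed

lemma \<delta>_eq_2: "\<delta> = 2"
proof -
  have "\<delta> \<noteq> 1"
  proof
    assume \<delta>: "\<delta> = 1"
    \<comment> \<open>With step \<open>1\<close>, index \<open>1\<close> is at odd distance from the
      highest weight.\<close>
    have "A.\<kappa> 1 = 0"
    proof (rule ccontr)
      assume "A.\<kappa> 1 \<noteq> 0"
      then have "2 * int (A.ex 1) = 1"
        using A.weight_eq(1)[of 1] n_pos \<delta> progression(1)[of 1] by simp
      then show False by presburger
    qed
    then have "(\<Sum>l\<le>n + m. RD (upper 1) 0 l * T 1 1 l) = 0"
      using first_row_mult[of "upper 1" 1 1] n_pos m_pos by (simp add: A.\<kappa>_def)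
    also have "(\<Sum>l\<le>n + m. RD (upper 1) 0 l * T 1 1 l)
        = (\<Sum>l\<le>n + m. if l = 2 then RD (upper 1) 0 2 * T 1 1 2 else 0)"
      using T_support[of 1 1] n_pos m_pos by (intro sum.cong) (auto simp: numeral_2_eq_2)
    finally have "RD (upper 1) 0 2 * T 1 1 2 = 0" using n_pos m_pos by simp
    then have "D.\<kappa> 2 = 0" using T_nonzero[of 1 1] n_pos m_pos by (simp add: D.\<kappa>_def numeral_2_eq_2)
    moreover have "D.N \<noteq> 0"
      using weights_add[of 0 0] A_nontrivial B_nontrivial A.a0 B.a0 D.a0 by auto
    then obtain l where l: "l \<le> n + m" "D.\<kappa> l \<noteq> 0" "D.ex l = 1" using D.monomial_occurs[of 1] by auto
    \<comment> \<open>Exponent \<open>1\<close> means weight \<open>d 0 - 2\<close>, which at step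
      \<open>1\<close> sits at index \<open>2\<close>, where \<open>D.\<kappa>\<close>
      vanishes.\<close>
    then have "l = 2" using D.weight_eq(1)[OF l(1,2)] progression(3)[OF l(1)] \<delta> by simp
    ultimately show False using l by simp
  qed
  then show ?thesis using \<delta>_cases by simp
qed

lemma irreducible:
  "irreducible_weight_rep n a RA" "irreducible_weight_rep m b RB" "irreducible_weight_rep (n + m) d RD"
proof -
  have "irreducible_weight_rep_axioms n a"
    unfolding irreducible_weight_rep_axioms_def by (intro conjI allI impI n_pos progression(1)[unfolded \<delta>_eq_2])
  then show "irreducible_weight_rep n a RA"
    by (rule irreducible_weight_rep.intro[OF A.weight_rep_axioms])
  have "irreducible_weight_rep_axioms m b"
    unfolding irreducible_weight_rep_axioms_def by (intro conjI allI impI m_pos progression(2)[unfolded \<delta>_eq_2])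
  then show "irreducible_weight_rep m b RB"
    by (rule irreducible_weight_rep.intro[OF B.weight_rep_axioms])
  have "irreducible_weight_rep_axioms (n + m) d"
    unfolding irreducible_weight_rep_axioms_def by (intro conjI allI impI trans_le_add1[OF n_pos] progression(3)[unfolded \<delta>_eq_2])
  then show "irreducible_weight_rep (n + m) d RD"
    by (rule irreducible_weight_rep.intro[OF D.weight_rep_axioms])
qed

end

section \<open>Existence of ordered weight bases, and their duals\<close>

section \<open>Weight bases of modules\<close>

lemma poly_vanishing_on_units:
  fixes p :: "complex poly"
  assumes "\<And>t. t \<noteq> 0 \<Longrightarrow> poly p t = 0"
  shows "p = 0"
proof -
  have "poly ([:0, 1:] * p) t = poly 0 t" for t
    using assms by (cases "t = 0") auto
  then have "[:0, 1:] * p = 0" using poly_eq_poly_eq_iff by blast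
  then show ?thesis by simp
qed

lemma entry_polynomial_continuous: "entry_polynomial p \<Longrightarrow> continuous_on S p"
  by (induction rule: entry_polynomial.induct) (auto intro!: continuous_intros)

text \<open>On the torus a regular function is a Laurent polynomial; \<open>t ^ K\<close> clears its
  denominator.\<close>

lemma entry_polynomial_torus:
  assumes "entry_polynomial p"
  shows "\<exists>K q. \<forall>t. t \<noteq> 0 \<longrightarrow> p (torus t) * t ^ K = poly q t"
  using assms
proof (induction rule: entry_polynomial.induct)
  case (const c)
  show ?case by (rule exI[of _ 0], rule exI[of _ "[:c:]"]) simp
next
  case (entry i j)
  consider "i = 1" "j = 1" | "i = 1" "j = 2" | "i = 2" "j = 1" | "i = 2" "j = 2"
    using exhaust_2 by metis
  then show ?case
  proof cases
    case 1
    show ?thesis by (rule exI[of _ 0], rule exI[of _ "[:0, 1:]"]) (simp add: 1)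
  next
    case 2
    show ?thesis by (rule exI[of _ 0], rule exI[of _ 0]) (simp add: 2)
  next
    case 3
    show ?thesis by (rule exI[of _ 0], rule exI[of _ 0]) (simp add: 3)
  next
    case 4
    show ?thesis by (rule exI[of _ 1], rule exI[of _ 1]) (simp add: 4)
  qed
next
  case (add p1 p2)
  then obtain K1 q1 K2 q2 where
      q: "\<And>t. t \<noteq> 0 \<Longrightarrow> p1 (torus t) * t ^ K1 = poly q1 t" "\<And>t. t \<noteq> 0 \<Longrightarrow> p2 (torus t) * t ^ K2 = poly q2 t"
    by blast
  show ?case
    by (rule exI[of _ "K1 + K2"], rule exI[of _ "q1 * monom 1 K2 + q2 * monom 1 K1"])
       (simp add: q[symmetric] poly_monom algebra_simps power_add)
next
  case (mult p1 p2)
  then obtain K1 q1 K2 q2 where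
      q: "\<And>t. t \<noteq> 0 \<Longrightarrow> p1 (torus t) * t ^ K1 = poly q1 t" "\<And>t. t \<noteq> 0 \<Longrightarrow> p2 (torus t) * t ^ K2 = poly q2 t"
    by blast
  show ?case
    by (rule exI[of _ "K1 + K2"], rule exI[of _ "q1 * q2"])
       (simp add: q[symmetric] algebra_simps power_add)
qed

context SL2_module
begin

lemma act_sum:
  assumes "g \<in> SL2" "\<And>i. i \<in> I \<Longrightarrow> f i \<in> V"
  shows "\<rho> g (\<Sum>i\<in>I. f i) = (\<Sum>i\<in>I. \<rho> g (f i))"
  using assms(2)
proof (induction I rule: infinite_finite_induct)
  case (insert i I)
  then show ?case using assms(1) by (simp add: act_add subspace_sum[OF carrier_subspace])
next
  case empty
  have "\<rho> g (0 + 0) = \<rho> g 0 + \<rho> g 0"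
    by (rule act_add) (use assms(1) subspace_0[OF carrier_subspace] in auto)
  then show ?case by simp
next
  case (infinite I)
  have "\<rho> g (0 + 0) = \<rho> g 0 + \<rho> g 0"
    by (rule act_add) (use assms(1) subspace_0[OF carrier_subspace] in auto)
  then show ?case using infinite by simp
qed

text \<open>Zero qualifies for every weight; it drops out once a basis is extracted.\<close>

definition weight_vector :: "int \<Rightarrow> 'a \<Rightarrow> bool" where
  "weight_vector k v \<longleftrightarrow> (\<forall>t. t \<noteq> 0 \<longrightarrow> \<rho> (torus t) v = scale (t powi k) v)"

text \<open>The orbit map of the torus at \<open>v\<close> is a Laurent polynomial with vector coefficients; comparing
  coefficients in \<open>\<rho> (torus s) (\<rho> (torus t) v) = \<rho> (torus (s t)) v\<close> shows that these are
  weight vectors, and they sum to \<open>v\<close>.\<close>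

lemma span_weight_vectors:
  assumes V: "V = UNIV"
  shows "span {v. \<exists>k. weight_vector k v} = UNIV"
proof -
  have "v \<in> span {v. \<exists>k. weight_vector k v}" for v
  proof -
    obtain B where B: "finite B" "span B = UNIV" using finite_dim V by auto
    obtain E where E: "E \<subseteq> B" "independent E" "B \<subseteq> span E" using maximal_independent_subset by blast
    have spanE: "span E = UNIV" using E(3) B(2) by (metis UNIV_I span_minimal subset_antisym subset_UNIV subspace_span)
    have finE: "finite E" using E(1) B(1) by (rule finite_subset)
    let ?r = "\<lambda>b u. representation E u b"
    have lin: "Vector_Spaces.linear scale (*) (?r b)" for b
      by (rule linear_representation[OF E(2) spanE])
    have expand: "(\<Sum>b\<in>E. scale (?r b u) b) = u" for u
      by (rule sum_representation_eq[OF E(2)]) (auto simp: spanE finE)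
    have scale_expand: "scale c u = (\<Sum>b\<in>E. scale (c * ?r b u) b)" for c u
    proof -
      have "scale c (\<Sum>b\<in>E. scale (?r b u) b) = (\<Sum>b\<in>E. scale (c * ?r b u) b)"
        by (simp add: scale_sum_right)
      then show ?thesis by (simp only: expand)
    qed
    have r_scale: "?r b (scale c u) = c * ?r b u" for b c u
      by (simp add: representation_scale[OF E(2)] spanE)
    have r_diff: "?r b (u - w) = ?r b u - ?r b w" for b u w
      by (simp add: representation_diff[OF E(2)] spanE)
    have r_sum: "?r b (\<Sum>i\<in>I. f i) = (\<Sum>i\<in>I. ?r b (f i))" for b f and I :: "nat set"
      by (simp add: representation_sum[OF E(2)] spanE)
    have "\<exists>K q. \<forall>t. t \<noteq> 0 \<longrightarrow> ?r b (\<rho> (torus t) v) * t ^ K = poly q t" for b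
    proof -
      obtain p where p: "entry_polynomial p" "\<forall>g\<in>SL2. ?r b (\<rho> g v) = p g"
        using algebraic[OF _ lin[of b], of v] V by auto
      then show ?thesis using entry_polynomial_torus[OF p(1)] by simp
    qed
    then obtain K q where Kq: "\<And>b t. t \<noteq> 0 \<Longrightarrow> ?r b (\<rho> (torus t) v) * t ^ K b = poly (q b) t"
      by metis
    \<comment> \<open>The sums are common bounds: \<open>t ^ L\<close> clears the denominators of
      all coordinates, and \<open>M\<close> bounds the degrees. The vector \<open>w k\<close>
      collects the coefficients of \<open>t ^ k\<close>, so its weight will be
      \<open>k - L\<close>.\<close>
    define L where "L = (\<Sum>b\<in>E. K b)"
    define Q where "Q = (\<lambda>b. q b * monom 1 (L - K b))"
    define M where "M = (\<Sum>b\<in>E. degree (Q b))"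
    define w where "w = (\<lambda>k. \<Sum>b\<in>E. scale (coeff (Q b) k) b)"
    have rQ: "?r b (\<rho> (torus t) v) * t ^ L = poly (Q b) t" if "t \<noteq> 0" "b \<in> E" for b t
    proof -
      have "K b \<le> L" unfolding L_def by (rule member_le_sum) (use that finE in auto)
      then have "t ^ L = t ^ K b * t ^ (L - K b)" by (simp flip: power_add)
      then show ?thesis using Kq[OF that(1), of b] by (simp add: Q_def poly_monom)
    qed
    have orbit: "scale (t ^ L) (\<rho> (torus t) v) = (\<Sum>k\<le>M. scale (t ^ k) (w k))" if "t \<noteq> 0" for t
    proof -
      have "scale (t ^ L) (\<rho> (torus t) v) = (\<Sum>b\<in>E. scale (t ^ L * ?r b (\<rho> (torus t) v)) b)"
        using scale_expand .
      also have "\<dots> = (\<Sum>b\<in>E. \<Sum>k\<le>M. scale (t ^ k * coeff (Q b) k) b)"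
      proof (rule sum.cong[OF refl])
        fix b assume b: "b \<in> E"
        have "degree (Q b) \<le> M" unfolding M_def by (rule member_le_sum) (use b finE in auto)
        then have "poly (Q b) t = (\<Sum>k\<le>M. coeff (Q b) k * t ^ k)"
          unfolding poly_altdef by (intro sum.mono_neutral_left) (auto simp: coeff_eq_0)
        then have "t ^ L * ?r b (\<rho> (torus t) v) = (\<Sum>k\<le>M. t ^ k * coeff (Q b) k)"
          using rQ[OF that b] by (simp add: mult.commute)
        then show "scale (t ^ L * ?r b (\<rho> (torus t) v)) b = (\<Sum>k\<le>M. scale (t ^ k * coeff (Q b) k) b)"
          by (simp add: scale_sum_left)
      qed
      also have "\<dots> = (\<Sum>k\<le>M. scale (t ^ k) (w k))"
        by (subst sum.swap) (simp add: w_def scale_sum_right)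
      finally show ?thesis .
    qed
    have weight: "weight_vector (int k - int L) (w k)" if "k \<le> M" for k
      unfolding weight_vector_def
    proof (intro allI impI)
      fix s :: complex assume s: "s \<noteq> 0"
      have sSL: "torus s \<in> SL2" using s by simp
      \<comment> \<open>The discrepancy at \<open>t ^ k\<close> between the two expansions of the
        action of \<open>torus (s * t)\<close>. The polynomial in \<open>t\<close> with these
        coefficients vanishes for \<open>t \<noteq> 0\<close>, so each coefficient is zero.\<close>
      define z where "z = (\<lambda>k. scale (s ^ L) (\<rho> (torus s) (w k)) - scale (s ^ k) (w k))"
      have z_sum: "(\<Sum>k\<le>M. scale (t ^ k) (z k)) = 0" if t: "t \<noteq> 0" for t
      proof -
        have "torus s ** torus t = torus (s * t)" by (simp add: mat2_mult mat2_eq_iff)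
        then have "\<rho> (torus s) (\<rho> (torus t) v) = \<rho> (torus (s * t)) v"
          using act_mult[of "torus s" "torus t" v] s t V by simp
        then have "scale (s ^ L) (scale (t ^ L) (\<rho> (torus s) (\<rho> (torus t) v))) = (\<Sum>k\<le>M. scale ((s * t) ^ k) (w k))"
          using orbit[of "s * t"] s t by (simp add: power_mult_distrib)
        moreover have "scale (t ^ L) (\<rho> (torus s) (\<rho> (torus t) v)) = (\<Sum>k\<le>M. scale (t ^ k) (\<rho> (torus s) (w k)))"
        proof -
          have "scale (t ^ L) (\<rho> (torus s) (\<rho> (torus t) v)) = \<rho> (torus s) (scale (t ^ L) (\<rho> (torus t) v))"
            by (rule act_scale[symmetric]) (use sSL V in auto)
          also have "\<dots> = (\<Sum>k\<le>M. \<rho> (torus s) (scale (t ^ k) (w k)))"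
            unfolding orbit[OF t] by (rule act_sum) (use sSL V in auto)
          also have "\<dots> = (\<Sum>k\<le>M. scale (t ^ k) (\<rho> (torus s) (w k)))"
            using sSL V by (simp add: act_scale)
          finally show ?thesis .
        qed
        moreover have "(\<Sum>k\<le>M. scale (t ^ k) (z k))
            = scale (s ^ L) (\<Sum>k\<le>M. scale (t ^ k) (\<rho> (torus s) (w k))) - (\<Sum>k\<le>M. scale ((s * t) ^ k) (w k))"
          by (simp add: z_def scale_right_diff_distrib sum_subtractf scale_sum_right power_mult_distrib mult.commute)
        ultimately show ?thesis by (simp only: diff_self)
      qed
      have "?r b (z k) = 0" for b
      proof -
        have "poly (\<Sum>k\<le>M. monom (?r b (z k)) k) t = 0" if "t \<noteq> 0" for t
        proof -
          have "0 = ?r b (\<Sum>k\<le>M. scale (t ^ k) (z k))"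
            using z_sum[OF that] by (simp add: representation_zero)
          also have "\<dots> = (\<Sum>k\<le>M. t ^ k * ?r b (z k))" by (simp add: r_sum r_scale)
          finally show ?thesis by (simp add: poly_sum poly_monom mult.commute)
        qed
        then have "(\<Sum>k\<le>M. monom (?r b (z k)) k) = 0" by (rule poly_vanishing_on_units)
        then have "coeff (\<Sum>k\<le>M. monom (?r b (z k)) k) k = 0" by simp
        then show ?thesis using that by (simp add: coeff_sum)
      qed
      then have "z k = 0" using expand[of "z k"] by simp
      then have zero: "scale (s powi - int L) (scale (s ^ L) (\<rho> (torus s) (w k))) = scale (s powi - int L) (scale (s ^ k) (w k))"
        by (simp add: z_def)
      show "\<rho> (torus s) (w k) = scale (s powi (int k - int L)) (w k)"
      proof -
        have "s powi - int L * s ^ L = 1" "s powi - int L * s ^ k = s powi (int k - int L)"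
          using s by (simp_all add: power_int_minus power_int_diff divide_inverse)
        then show ?thesis
          using zero by (simp only: scale_scale scale_one)
      qed
    qed
    have "mat 1 = torus 1" by (simp add: mat_1_eq_mat2)
    then have "v = (\<Sum>k\<le>M. w k)" using orbit[of 1] act_one[of v] V by simp
    also have "\<dots> \<in> span {v. \<exists>k. weight_vector k v}"
      using weight by (intro span_sum span_base) auto
    finally show ?thesis .
  qed
  then show ?thesis by auto
qed

end

text \<open>A weight basis together with its dual basis \<open>x\<close>. No order is imposed on the
  weights, since both directions occur: the dual of a module needs the opposite one.\<close>

locale weight_basis = SL2_module scale UNIV \<rho>
  for scale :: "complex \<Rightarrow> 'a::ab_group_add \<Rightarrow> 'a" and \<rho> +
  fixes n :: nat and e :: "nat \<Rightarrow> 'a" and x :: "nat \<Rightarrow> 'a \<Rightarrow> complex" and a :: "nat \<Rightarrow> int"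
  assumes expand: "(\<Sum>i\<le>n. scale (x i v) (e i)) = v"
    and x_e: "i \<le> n \<Longrightarrow> j \<le> n \<Longrightarrow> x i (e j) = (if i = j then 1 else 0)"
    and x_linear: "Vector_Spaces.linear scale (*) (x i)"
    and torus_e: "t \<noteq> 0 \<Longrightarrow> i \<le> n \<Longrightarrow> \<rho> (torus t) (e i) = scale (t powi a i) (e i)"
begin

definition R :: "complex^2^2 \<Rightarrow> nat \<Rightarrow> nat \<Rightarrow> complex" where
  "R g i j = x i (\<rho> g (e j))"

lemma x_add: "x i (v + w) = x i v + x i w" and x_scale: "x i (scale k v) = k * x i v"
  using x_linear[of i] by (simp_all add: Vector_Spaces.linear_iff)

lemma functional_expand:
  assumes "Vector_Spaces.linear scale (*) f"
  shows "f v = (\<Sum>i\<le>n. x i v * f (e i))"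
proof -
  interpret f: Vector_Spaces.linear scale "(*)" f by fact
  have "f v = f (\<Sum>i\<le>n. scale (x i v) (e i))" by (simp add: expand)
  also have "\<dots> = (\<Sum>i\<le>n. x i v * f (e i))" by (simp add: f.sum f.scale)
  finally show ?thesis .
qed

lemma x_sum:
  assumes "i \<le> n"
  shows "x i (\<Sum>k\<le>n. scale (u k) (e k)) = u i"
proof -
  interpret x: Vector_Spaces.linear scale "(*)" "x i" by (rule x_linear)
  have "x i (\<Sum>k\<le>n. scale (u k) (e k)) = (\<Sum>k\<le>n. if k = i then u i else 0)"
    unfolding x.sum x.scale using assms by (intro sum.cong) (auto simp: x_e)
  then show ?thesis using assms by simp
qed

lemma coordinates_inject:
  assumes "\<And>i. i \<le> n \<Longrightarrow> x i v = x i w"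
  shows "v = w"
proof -
  have "(\<Sum>i\<le>n. scale (x i v) (e i)) = (\<Sum>i\<le>n. scale (x i w) (e i))" using assms by simp
  then show ?thesis by (simp only: expand)
qed

lemma nonzero_coordinate:
  assumes "v \<noteq> 0"
  obtains i where "i \<le> n" "x i v \<noteq> 0"
proof -
  have "\<exists>i\<le>n. x i v \<noteq> x i 0" using coordinates_inject[of v 0] assms by blast
  then show ?thesis using that x_scale[of _ 0 0] by auto
qed

lemma x_act:
  assumes "g \<in> SL2"
  shows "x i (\<rho> g v) = (\<Sum>j\<le>n. R g i j * x j v)"
proof -
  have "Vector_Spaces.linear scale (*) (\<lambda>v. x i (\<rho> g v))"
    using x_linear[of i] assms unfolding Vector_Spaces.linear_iff by (simp add: act_add act_scale)
  from functional_expand[OF this, of v] show ?thesis unfolding R_def by (simp only: mult.commute)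
qed

lemma R_mult:
  assumes "g \<in> SL2" "h \<in> SL2"
  shows "R (g ** h) i j = (\<Sum>k\<le>n. R g i k * R h k j)"
  using x_act[OF assms(1), of i "\<rho> h (e j)"] assms unfolding R_def[of _ _ j] by (simp only: act_mult UNIV_I)

lemma R_torus:
  assumes "t \<noteq> 0" "i \<le> n" "j \<le> n"
  shows "R (torus t) i j = (if i = j then t powi a i else 0)"
  using assms by (simp add: R_def torus_e x_scale x_e)

lemma R_cont: "continuous_on SL2 (\<lambda>g. R g i j)"
proof -
  obtain p where p: "entry_polynomial p" "\<forall>g\<in>SL2. x i (\<rho> g (e j)) = p g"
    using algebraic[OF _ x_linear, of "e j" i] by auto
  then show ?thesis
    using entry_polynomial_continuous[OF p(1), of SL2] by (simp add: R_def cong: continuous_on_cong)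
qed

lemma weight_rep:
  assumes "\<And>i j. i \<le> j \<Longrightarrow> j \<le> n \<Longrightarrow> a j \<le> a i"
  shows "weight_rep n a R"
  by unfold_locales (simp_all add: R_mult R_torus R_cont assms)

text \<open>On the dual basis the group acts by the inverse transpose, which negates the weights and
  so reverses their order.\<close>

lemma dual_weight_rep:
  assumes "\<And>i j. i \<le> j \<Longrightarrow> j \<le> n \<Longrightarrow> a i \<le> a j"
  shows "weight_rep n (\<lambda>i. - a i) (\<lambda>g i j. R (matrix_inv g) j i)"
proof
  show "R (matrix_inv (g ** h)) j i = (\<Sum>k\<le>n. R (matrix_inv g) k i * R (matrix_inv h) j k)"
    if "g \<in> SL2" "h \<in> SL2" for g h i j
    using that by (simp add: matrix_inv_mult_SL2 R_mult mult.commute)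
  show "R (matrix_inv (torus t)) j i = (if i = j then t powi - a i else 0)"
    if "t \<noteq> 0" "i \<le> n" "j \<le> n" for t i j
  proof -
    have "matrix_inv (torus t) = torus (1 / t)" using that by (subst matrix_inv_mat2) auto
    moreover have "(1 / t) powi k = t powi (- k)" for k
      by (simp add: power_int_divide_distrib power_int_minus inverse_eq_divide)
    ultimately show ?thesis using that R_torus[of "1 / t" j i] by auto
  qed
  show "continuous_on SL2 (\<lambda>g. R (matrix_inv g) j i)" for i j
    by (rule continuous_on_compose2[OF R_cont continuous_on_matrix_inv_SL2]) auto
qed (use assms in auto)

lemma trivial_action:
  assumes "\<And>g i j. g \<in> SL2 \<Longrightarrow> i \<le> n \<Longrightarrow> j \<le> n \<Longrightarrow> R g i j = (if i = j then 1 else 0)"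
  shows "\<not> nontrivial_action UNIV \<rho>"
proof -
  have "\<rho> g v = v" if "g \<in> SL2" for g v
  proof -
    have "x i (\<rho> g v) = x i v" if "i \<le> n" for i
    proof -
      have "x i (\<rho> g v) = (\<Sum>j\<le>n. if j = i then x j v else 0)"
        unfolding x_act[OF \<open>g \<in> SL2\<close>] using that \<open>g \<in> SL2\<close> by (intro sum.cong) (auto simp: assms)
      then show ?thesis using that by simp
    qed
    then show ?thesis by (rule coordinates_inject)
  qed
  then show ?thesis by (simp add: nontrivial_action_def)
qed

lemma reverse: "weight_basis scale \<rho> n (\<lambda>i. e (n - i)) (\<lambda>i. x (n - i)) (\<lambda>i. a (n - i))"
proof (intro weight_basis.intro weight_basis_axioms.intro)
  show "SL2_module scale UNIV \<rho>" by unfold_locales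
  show "(\<Sum>i\<le>n. scale (x (n - i) v) (e (n - i))) = v" for v
    using sum.atLeastAtMost_rev[of "\<lambda>i. scale (x i v) (e i)" 0 n] expand[of v] by (simp add: atMost_atLeast0)
qed (auto simp: x_e x_linear torus_e)

end

text \<open>The weight vectors span, so a maximal independent set of them is a basis; sorting by the
  negated weight makes the weights decrease.\<close>

lemma exists_weight_basis:
  fixes scale :: "complex \<Rightarrow> 'a::ab_group_add \<Rightarrow> 'a" and \<rho> :: "complex^2^2 \<Rightarrow> 'a \<Rightarrow> 'a"
  assumes "SL2_module scale UNIV \<rho>" and dim: "vector_space.dim scale UNIV = n + 1"
  obtains e x a where "weight_basis scale \<rho> n e x a" "\<And>i j. i \<le> j \<Longrightarrow> j \<le> n \<Longrightarrow> a j \<le> a i"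
proof -
  interpret SL2_module scale UNIV \<rho> by fact
  obtain B where B: "B \<subseteq> {v. \<exists>k. weight_vector k v}" "independent B" "{v. \<exists>k. weight_vector k v} \<subseteq> span B"
    using maximal_independent_subset by blast
  have spanB: "span B = UNIV"
    using span_weight_vectors B(3) by (metis UNIV_I span_minimal subset_antisym subset_UNIV subspace_span)
  have card: "card B = n + 1" using dim_eq_card[of B UNIV] B(2) spanB dim by simp
  then have fin: "finite B" by (metis Suc_eq_plus1 card.infinite nat.distinct(1))
  define wt where "wt = (\<lambda>v. SOME k. weight_vector k v)"
  have wt: "weight_vector (wt v) v" if "v \<in> B" for v
    using B(1) that unfolding wt_def by (metis (mono_tags, lifting) mem_Collect_eq someI_ex subsetD)
  obtain ys where ys: "set ys = B" "distinct ys" using finite_distinct_list[OF fin] by blast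
  define xs where "xs = sort_key (\<lambda>v. - wt v) ys"
  have xs: "set xs = B" "distinct xs" "length xs = n + 1"
    using ys card by (simp_all add: xs_def flip: distinct_card)
  have "sorted (map (\<lambda>v. - wt v) xs)" by (simp add: xs_def)
  then have mono: "wt (xs ! j) \<le> wt (xs ! i)" if "i \<le> j" "j \<le> n" for i j
    using that xs(3) sorted_nth_mono[of "map (\<lambda>v. - wt v) xs" i j] by simp
  have bij: "bij_betw ((!) xs) {..n} B"
    using bij_betw_nth[OF xs(2), of "{..<n + 1}" B] xs by (simp add: lessThan_Suc_atMost)
  have inB: "xs ! i \<in> B" if "i \<le> n" for i using that xs by (metis less_Suc_eq_le nth_mem Suc_eq_plus1)
  have "weight_basis scale \<rho> n ((!) xs) (\<lambda>i v. representation B v (xs ! i)) (\<lambda>i. wt (xs ! i))"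
  proof (intro weight_basis.intro weight_basis_axioms.intro)
    show "SL2_module scale UNIV \<rho>" by fact
    show "(\<Sum>i\<le>n. scale (representation B v (xs ! i)) (xs ! i)) = v" for v
    proof -
      have "(\<Sum>i\<le>n. scale (representation B v (xs ! i)) (xs ! i)) = (\<Sum>b\<in>B. scale (representation B v b) b)"
        by (rule sum.reindex_bij_betw[OF bij])
      also have "\<dots> = v" by (rule sum_representation_eq[OF B(2)]) (auto simp: spanB fin)
      finally show ?thesis .
    qed
    show "representation B (xs ! j) (xs ! i) = (if i = j then 1 else 0)" if "i \<le> n" "j \<le> n" for i j
      using that xs representation_basis[OF B(2) inB[of j]] by (simp add: nth_eq_iff_index_eq)
    show "Vector_Spaces.linear scale (*) (\<lambda>v. representation B v (xs ! i))" for i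
      by (rule linear_representation[OF B(2) spanB])
    show "\<rho> (torus t) (xs ! i) = scale (t powi wt (xs ! i)) (xs ! i)" if "t \<noteq> 0" "i \<le> n" for t i
      using wt[OF inB] that by (simp add: weight_vector_def)
  qed
  then show ?thesis using that mono by blast
qed

section \<open>Binary forms and the equivariant isomorphism onto them\<close>

section \<open>Binary forms\<close>

definition form :: "nat \<Rightarrow> (nat \<Rightarrow> complex) \<Rightarrow> complex^2 \<Rightarrow> complex" where
  "form n c = (\<lambda>v. \<Sum>k\<le>n. c k * ((v $ 1) ^ (n - k) * (v $ 2) ^ k))"

lemma binary_forms_eq_range: "binary_forms n = range (form n)"
  by (auto simp: binary_forms_def form_def)

lemma form_add: "form n (\<lambda>k. c k + d k) = form n c + form n d"
  by (simp add: form_def fun_eq_iff sum.distrib distrib_right)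

lemma form_scale: "form n (\<lambda>k. r * c k) = fun_scale r (form n c)"
  by (simp add: form_def fun_scale_def fun_eq_iff sum_distrib_left mult_ac)

text \<open>Setting \<open>x = 1\<close> keeps all coefficients, so their uniqueness and the absence
  of zero divisors come from polynomials in one variable.\<close>

lemma form_dehomogenized: "form n c (vector [1, t]) = poly (\<Sum>k\<le>n. monom (c k) k) t"
  by (simp add: form_def poly_sum poly_monom)

lemma form_poly_eq_0:
  assumes "(\<Sum>k\<le>n. monom (c k) k) = 0" "k \<le> n"
  shows "c k = 0"
proof -
  have "coeff (\<Sum>k\<le>n. monom (c k) k) k = 0" using assms(1) by simp
  then show ?thesis using assms(2) by (simp add: coeff_sum)
qed

lemma form_inject:
  assumes "form n c = form n d" "k \<le> n"
  shows "c k = d k"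
proof -
  have "poly (\<Sum>k\<le>n. monom (c k) k) = poly (\<Sum>k\<le>n. monom (d k) k)"
    using assms(1) by (auto simp: fun_eq_iff form_dehomogenized[symmetric])
  then have "(\<Sum>k\<le>n. monom (c k) k) - (\<Sum>k\<le>n. monom (d k) k) = 0"
    by (simp add: poly_eq_poly_eq_iff)
  then have "(\<Sum>k\<le>n. monom (c k - d k) k) = 0"
    by (simp add: sum_subtractf flip: diff_monom)
  from form_poly_eq_0[OF this assms(2)] show ?thesis by simp
qed

lemma binary_forms_no_zero_divisors:
  assumes "f \<in> binary_forms n" "g \<in> binary_forms m" "f * g = 0"
  shows "f = 0 \<or> g = 0"
proof -
  obtain c d where f: "f = form n c" and g: "g = form m d"
    using assms(1,2) by (auto simp: binary_forms_eq_range)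
  let ?P = "\<Sum>k\<le>n. monom (c k) k" and ?Q = "\<Sum>k\<le>m. monom (d k) k"
  have "poly (?P * ?Q) t = poly 0 t" for t
    using fun_cong[OF assms(3), of "vector [1, t]"] by (simp add: f g form_dehomogenized)
  then have "?P * ?Q = 0" using poly_eq_poly_eq_iff by blast
  then consider "?P = 0" | "?Q = 0" by auto
  then show ?thesis
  proof cases
    case 1
    then have "f = 0" using form_poly_eq_0[of c n] by (simp add: f form_def fun_eq_iff)
    then show ?thesis ..
  next
    case 2
    then have "g = 0" using form_poly_eq_0[of d m] by (simp add: g form_def fun_eq_iff)
    then show ?thesis ..
  qed
qed

lemma SL2_first_row:
  fixes w :: "complex^2"
  assumes "w \<noteq> 0"
  obtains h where "h \<in> SL2" "h $ 1 = w"
proof (cases "w $ 1 = 0")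
  case True
  then have "w $ 2 \<noteq> 0" using assms by (auto simp: vec_eq_iff forall_2)
  then show ?thesis
    using True by (intro that[of "mat2 0 (w $ 2) (- 1 / w $ 2) 0"]) (auto simp: vec_eq_iff forall_2)
next
  case False
  then show ?thesis
    by (intro that[of "mat2 (w $ 1) (w $ 2) 0 (1 / w $ 1)"]) (auto simp: vec_eq_iff forall_2)
qed

lemma first_row_matrix_mult: "(h ** g) $ 1 = h $ 1 v* (g :: complex^2^2)"
  by (simp add: vec_eq_iff matrix_matrix_mult_def vector_matrix_mult_def mult.commute)

context irreducible_weight_rep
begin

text \<open>The highest weight coordinate of the translate by \<open>h\<close> of the vector with coordinates \<open>u\<close>, as a
  function of the first row of \<open>h\<close>.\<close>

definition to_form :: "(nat \<Rightarrow> complex) \<Rightarrow> complex^2 \<Rightarrow> complex" where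
  "to_form u = form n (\<lambda>i. u i * \<kappa> i)"

lemma to_form_row:
  assumes "h \<in> SL2"
  shows "to_form u (h $ 1) = (\<Sum>i\<le>n. R h 0 i * u i)"
  using assms unfolding to_form_def form_def
  by (intro sum.cong) (auto simp: first_row N_eq ex_eq)

text \<open>The origin is not the first row of a matrix in the group, so arguments by rows do not
  reach it; positive degree settles it.\<close>

lemma to_form_0: "to_form u 0 = 0"
  using n_pos by (auto simp: to_form_def form_def power_0_left intro!: sum.neutral)

text \<open>The first row of \<open>h ** g\<close> is that of \<open>h\<close> multiplied by
  \<open>g\<close>, so acting on the vector amounts to substituting in the form.\<close>

lemma to_form_act:
  assumes "g \<in> SL2" "\<And>i. i \<le> n \<Longrightarrow> u' i = (\<Sum>j\<le>n. R g i j * u j)"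
  shows "to_form u' = forms_action g (to_form u)"
proof
  fix w
  show "to_form u' w = forms_action g (to_form u) w"
  proof (cases "w = 0")
    case True
    then show ?thesis by (simp add: forms_action_def to_form_0)
  next
    case False
    then obtain h where h: "h \<in> SL2" "h $ 1 = w" by (rule SL2_first_row)
    have "to_form u' w = (\<Sum>i\<le>n. \<Sum>j\<le>n. R h 0 i * (R g i j * u j))"
      using to_form_row[OF h(1)] h(2) by (simp add: assms(2) sum_distrib_left)
    also have "\<dots> = (\<Sum>j\<le>n. \<Sum>i\<le>n. R h 0 i * (R g i j * u j))" by (rule sum.swap)
    also have "\<dots> = (\<Sum>j\<le>n. R (h ** g) 0 j * u j)"
      using h(1) assms(1) by (intro sum.cong) (auto simp: R_mult sum_distrib_right mult.assoc)
    also have "\<dots> = to_form u (w v* g)"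
      using to_form_row[of "h ** g" u] h assms(1) by (simp add: first_row_matrix_mult)
    finally show ?thesis by (simp add: forms_action_def)
  qed
qed

text \<open>Stated for abstract coordinates on a carrier, so that it serves the modules and the dual
  space alike. Bijectivity holds because no \<open>\<kappa> i\<close> vanishes.\<close>

lemma SL2_iso_to_form:
  fixes x :: "nat \<Rightarrow> 'v::ab_group_add \<Rightarrow> complex"
  assumes inj: "\<And>v w. v \<in> V \<Longrightarrow> w \<in> V \<Longrightarrow> (\<And>i. i \<le> n \<Longrightarrow> x i v = x i w) \<Longrightarrow> v = w"
    and surj: "\<And>c. \<exists>v\<in>V. \<forall>i\<le>n. x i v = c i"
    and add: "\<And>i v w. v \<in> V \<Longrightarrow> w \<in> V \<Longrightarrow> x i (v + w) = x i v + x i w"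
    and scale: "\<And>i k v. v \<in> V \<Longrightarrow> x i (scaleV k v) = k * x i v"
    and act: "\<And>g i v. g \<in> SL2 \<Longrightarrow> v \<in> V \<Longrightarrow> i \<le> n \<Longrightarrow> x i (\<rho> g v) = (\<Sum>j\<le>n. R g i j * x j v)"
  shows "SL2_iso scaleV V \<rho> fun_scale (binary_forms n) forms_action (\<lambda>v. to_form (\<lambda>i. x i v))"
  unfolding SL2_iso_def
proof (intro conjI ballI allI)
  show "bij_betw (\<lambda>v. to_form (\<lambda>i. x i v)) V (binary_forms n)"
    unfolding bij_betw_def
  proof
    show "inj_on (\<lambda>v. to_form (\<lambda>i. x i v)) V"
    proof (rule inj_onI)
      fix v w assume vw: "v \<in> V" "w \<in> V" "to_form (\<lambda>i. x i v) = to_form (\<lambda>i. x i w)"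
      show "v = w"
      proof (rule inj[OF vw(1,2)])
        fix i assume "i \<le> n"
        then show "x i v = x i w"
          using form_inject[OF vw(3)[unfolded to_form_def]] \<kappa>_nonzero by simp
      qed
    qed
    have "form n c \<in> (\<lambda>v. to_form (\<lambda>i. x i v)) ` V" for c
    proof -
      obtain v where v: "v \<in> V" "\<forall>i\<le>n. x i v = c i / \<kappa> i" using surj[of "\<lambda>i. c i / \<kappa> i"] by blast
      have "to_form (\<lambda>i. x i v) = form n c"
        using v(2) \<kappa>_nonzero by (simp add: to_form_def form_def)
      then show ?thesis using v(1) by force
    qed
    then show "(\<lambda>v. to_form (\<lambda>i. x i v)) ` V = binary_forms n"
      by (auto simp: binary_forms_eq_range to_form_def)
  qed
  show "to_form (\<lambda>i. x i (v + w)) = to_form (\<lambda>i. x i v) + to_form (\<lambda>i. x i w)" if "v \<in> V" "w \<in> V" for v w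
    using that by (simp add: to_form_def add distrib_right form_add)
  show "to_form (\<lambda>i. x i (scaleV k v)) = fun_scale k (to_form (\<lambda>i. x i v))" if "v \<in> V" for k v
    using that by (simp add: to_form_def scale mult.assoc form_scale)
  show "to_form (\<lambda>i. x i (\<rho> g v)) = forms_action g (to_form (\<lambda>i. x i v))" if "g \<in> SL2" "v \<in> V" for g v
    by (rule to_form_act) (use that act in auto)
qed

end

section \<open>From a nowhere tangent invariant hyperplane to multiplication of forms\<close>

section \<open>Invariant trilinear forms\<close>

text \<open>The scalars, read off where \<open>\<phi>\<close> is nonzero, form a character and are
  therefore \<open>1\<close>. Invariance is phrased with inverses, so it is applied at
  \<open>matrix_inv g\<close>.\<close>

lemma invariant_strictly:
  assumes A: "SL2_module scaleA UNIV \<rho>A" and B: "SL2_module scaleB UNIV \<rho>B" and C: "SL2_module scaleC UNIV \<rho>C"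
    and nz: "\<exists>a b c. \<phi> a b c \<noteq> 0" and inv: "hyperplane_invariant \<rho>A \<rho>B \<rho>C \<phi>" and g: "g \<in> SL2"
  shows "\<phi> (\<rho>A g a) (\<rho>B g b) (\<rho>C g c) = \<phi> a b c"
proof -
  obtain a0 b0 c0 where nz: "\<phi> a0 b0 c0 \<noteq> 0" using nz by blast
  define ch where "ch = (\<lambda>g. \<phi> (\<rho>A g a0) (\<rho>B g b0) (\<rho>C g c0) / \<phi> a0 b0 c0)"
  have ch: "ch g \<noteq> 0 \<and> (\<forall>a b c. \<phi> (\<rho>A g a) (\<rho>B g b) (\<rho>C g c) = ch g * \<phi> a b c)" if g: "g \<in> SL2" for g
  proof -
    obtain k where k: "k \<noteq> 0" "\<And>a b c. \<phi> (\<rho>A g a) (\<rho>B g b) (\<rho>C g c) = k * \<phi> a b c"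
      using inv matrix_inv_in_SL2[OF g] matrix_inv_matrix_inv_SL2[OF g]
      unfolding hyperplane_invariant_def by metis
    then have "ch g = k" using nz by (simp add: ch_def)
    then show ?thesis using k by simp
  qed
  have "ch g = 1"
  proof (rule SL2_character_trivial[OF g])
    show "ch (g ** h) = ch g * ch h" if "g \<in> SL2" "h \<in> SL2" for g h
    proof -
      have "ch (g ** h) * \<phi> a0 b0 c0 = \<phi> (\<rho>A (g ** h) a0) (\<rho>B (g ** h) b0) (\<rho>C (g ** h) c0)"
        using ch[of "g ** h"] that by simp
      also have "\<dots> = \<phi> (\<rho>A g (\<rho>A h a0)) (\<rho>B g (\<rho>B h b0)) (\<rho>C g (\<rho>C h c0))"
        using that SL2_module.act_mult[OF A] SL2_module.act_mult[OF B] SL2_module.act_mult[OF C] by simp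
      also have "\<dots> = ch g * (ch h * \<phi> a0 b0 c0)" using ch that by simp
      finally show ?thesis using nz by simp
    qed
  qed (use ch in blast)
  then show ?thesis using ch[OF g] by simp
qed

text \<open>The weights of \<open>C\<close> increase, so those of its dual, the target of the
  bilinear map, decrease.\<close>

locale weight_trilinear = A: weight_basis scaleA \<rho>A n eA xA wA + B: weight_basis scaleB \<rho>B m eB xB wB +
    C: weight_basis scaleC \<rho>C "n + m" eC xC wC
  for scaleA :: "complex \<Rightarrow> 'a::ab_group_add \<Rightarrow> 'a" and \<rho>A n eA xA wA
    and scaleB :: "complex \<Rightarrow> 'b::ab_group_add \<Rightarrow> 'b" and \<rho>B m eB xB wB
    and scaleC :: "complex \<Rightarrow> 'c::ab_group_add \<Rightarrow> 'c" and \<rho>C eC xC wC +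
  fixes \<phi> :: "'a \<Rightarrow> 'b \<Rightarrow> 'c \<Rightarrow> complex"
  assumes hyperplane: "hyperplane_form scaleA scaleB scaleC \<phi>"
    and invariant: "hyperplane_invariant \<rho>A \<rho>B \<rho>C \<phi>"
    and Det: "Det_nonzero \<phi>"
    and order_A: "i \<le> j \<Longrightarrow> j \<le> n \<Longrightarrow> wA j \<le> wA i" and order_B: "i \<le> j \<Longrightarrow> j \<le> m \<Longrightarrow> wB j \<le> wB i"
    and order_C: "i \<le> j \<Longrightarrow> j \<le> n + m \<Longrightarrow> wC i \<le> wC j"
    and nontrivial_A: "nontrivial_action UNIV \<rho>A" and nontrivial_B: "nontrivial_action UNIV \<rho>B"
begin

lemma linear_\<phi>:
  "Vector_Spaces.linear scaleA (*) (\<lambda>a. \<phi> a b c)" "Vector_Spaces.linear scaleB (*) (\<lambda>b. \<phi> a b c)"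
  "Vector_Spaces.linear scaleC (*) (\<lambda>c. \<phi> a b c)"
  using hyperplane by (simp_all add: hyperplane_form_def)

lemma \<phi>_A: "\<phi> a b c = (\<Sum>i\<le>n. xA i a * \<phi> (eA i) b c)"
  and \<phi>_B: "\<phi> a b c = (\<Sum>j\<le>m. xB j b * \<phi> a (eB j) c)"
  and \<phi>_C: "\<phi> a b c = (\<Sum>l\<le>n + m. xC l c * \<phi> a b (eC l))"
  by (rule A.functional_expand[OF linear_\<phi>(1)] B.functional_expand[OF linear_\<phi>(2)]
      C.functional_expand[OF linear_\<phi>(3)])+

lemma \<phi>_AB: "\<phi> a b c = (\<Sum>i\<le>n. \<Sum>j\<le>m. xA i a * xB j b * \<phi> (eA i) (eB j) c)"
proof -
  have "\<phi> a b c = (\<Sum>i\<le>n. xA i a * \<phi> (eA i) b c)" by (rule \<phi>_A)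
  also have "\<dots> = (\<Sum>i\<le>n. \<Sum>j\<le>m. xA i a * xB j b * \<phi> (eA i) (eB j) c)"
    by (intro sum.cong refl, subst \<phi>_B) (simp add: sum_distrib_left mult.assoc)
  finally show ?thesis .
qed

text \<open>If \<open>\<phi> a b\<close> vanished, a nonzero \<open>c\<close> killed by
  \<open>\<phi> a' b\<close> and \<open>\<phi> a b'\<close> for all \<open>a'\<close> and
  \<open>b'\<close> would give a tangency. Since \<open>\<phi> a b c = 0\<close> is automatic, one
  basis vector \<open>i0\<close> and one \<open>j0\<close> can be left out, which leaves
  \<open>n + m\<close> equations in \<open>n + m + 1\<close> unknowns.\<close>

lemma nonzero_value:
  assumes "a \<noteq> 0" "b \<noteq> 0"
  shows "\<exists>c. \<phi> a b c \<noteq> 0"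
proof (rule ccontr)
  assume "\<not> ?thesis"
  then have zero: "\<phi> a b c = 0" for c by simp
  obtain i0 where i0: "i0 \<le> n" "xA i0 a \<noteq> 0"
    using assms(1) by (rule A.nonzero_coordinate)
  obtain j0 where j0: "j0 \<le> m" "xB j0 b \<noteq> 0"
    using assms(2) by (rule B.nonzero_coordinate)
  let ?E = "({..n} - {i0}) <+> ({..m} - {j0})"
  define M where "M = (\<lambda>r l. case r of Inl i \<Rightarrow> \<phi> (eA i) b (eC l) | Inr j \<Rightarrow> \<phi> a (eB j) (eC l))"
  have "card ?E < card {..n + m}" using i0 j0 by (simp add: card_Plus)
  then obtain z where z: "\<exists>l\<in>{..n + m}. z l \<noteq> 0" "\<forall>r\<in>?E. (\<Sum>l\<le>n + m. M r l * z l) = 0"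
    using homogeneous_system_nontrivial_solution[of ?E "{..n + m}" M] by auto
  define c where "c = (\<Sum>l\<le>n + m. scaleC (z l) (eC l))"
  have \<phi>_c: "\<phi> a' b' c = (\<Sum>l\<le>n + m. z l * \<phi> a' b' (eC l))" for a' b'
  proof -
    interpret l: Vector_Spaces.linear scaleC "(*)" "\<lambda>c. \<phi> a' b' c" by (rule linear_\<phi>(3))
    show ?thesis by (simp add: c_def l.sum l.scale)
  qed
  have "c \<noteq> 0"
  proof
    obtain l where l: "l \<le> n + m" "z l \<noteq> 0" using z(1) by auto
    then have "xC l c = z l" unfolding c_def by (intro C.x_sum)
    moreover assume "c = 0"
    ultimately show False using l C.x_scale[of l 0 0] by simp
  qed
  have offA: "\<phi> (eA i) b c = 0" if "i \<le> n" "i \<noteq> i0" for i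
    using z(2)[rule_format, of "Inl i"] that by (simp add: \<phi>_c M_def mult.commute InlI)
  have offB: "\<phi> a (eB j) c = 0" if "j \<le> m" "j \<noteq> j0" for j
    using z(2)[rule_format, of "Inr j"] that by (simp add: \<phi>_c M_def mult.commute InrI)
  \<comment> \<open>The omitted equation is recovered: the left side is zero and \<open>a\<close>
    has a nonzero coordinate at \<open>i0\<close>.\<close>
  have "\<phi> a b c = (\<Sum>i\<le>n. if i = i0 then xA i0 a * \<phi> (eA i0) b c else 0)"
    unfolding \<phi>_A[of a] by (intro sum.cong) (auto simp: offA)
  then have "\<phi> (eA i0) b c = 0" using i0 zero by simp
  then have allA: "\<phi> a' b c = 0" for a'
    unfolding \<phi>_A[of a'] using offA by (intro sum.neutral) (metis atMost_iff mult_zero_right)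
  have "\<phi> a b c = (\<Sum>j\<le>m. if j = j0 then xB j0 b * \<phi> a (eB j0) c else 0)"
    unfolding \<phi>_B[of a b] by (intro sum.cong) (auto simp: offB)
  then have "\<phi> a (eB j0) c = 0" using j0 zero by simp
  then have allB: "\<phi> a b' c = 0" for b'
    unfolding \<phi>_B[of _ b'] using offB by (intro sum.neutral) (metis atMost_iff mult_zero_right)
  have "tangent_at \<phi> a b c" using allA allB zero by (simp add: tangent_at_def)
  then show False using Det assms \<open>c \<noteq> 0\<close> by (auto simp: Det_nonzero_def)
qed

end

context weight_trilinear
begin

abbreviation RD :: "complex^2^2 \<Rightarrow> nat \<Rightarrow> nat \<Rightarrow> complex" where
  "RD g i j \<equiv> C.R (matrix_inv g) j i"

abbreviation T :: "nat \<Rightarrow> nat \<Rightarrow> nat \<Rightarrow> complex" where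
  "T i j l \<equiv> \<phi> (eA i) (eB j) (eC l)"

lemma \<phi>_strictly_invariant: "g \<in> SL2 \<Longrightarrow> \<phi> (\<rho>A g a) (\<rho>B g b) (\<rho>C g c) = \<phi> a b c"
  by (rule invariant_strictly[OF A.SL2_module_axioms B.SL2_module_axioms C.SL2_module_axioms _ invariant])
     (use hyperplane in \<open>auto simp: hyperplane_form_def\<close>)

lemma dual_coordinates_act:
  assumes "g \<in> SL2" "Vector_Spaces.linear scaleC (*) f"
  shows "dual_action \<rho>C g f (eC i) = (\<Sum>j\<le>n + m. RD g i j * f (eC j))"
  using C.functional_expand[OF assms(2), of "\<rho>C (matrix_inv g) (eC i)"]
  by (simp only: dual_action_def C.R_def)

lemma boundary_tensor: "boundary_tensor n m wA wB (\<lambda>l. - wC l) A.R B.R RD T"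
proof (intro boundary_tensor.intro boundary_tensor_axioms.intro)
  show A: "weight_rep n wA A.R" by (rule A.weight_rep[OF order_A])
  show B: "weight_rep m wB B.R" by (rule B.weight_rep[OF order_B])
  show "weight_rep (n + m) (\<lambda>l. - wC l) RD" by (rule C.dual_weight_rep[OF order_C])
  show "weight_rep.N wA \<noteq> 0"
  proof
    assume "weight_rep.N wA = 0"
    from A.trivial_action[OF weight_rep.trivial_if_weights_0[OF A this]] show False
      using nontrivial_A by simp
  qed
  show "weight_rep.N wB \<noteq> 0"
  proof
    assume "weight_rep.N wB = 0"
    from B.trivial_action[OF weight_rep.trivial_if_weights_0[OF B this]] show False
      using nontrivial_B by simp
  qed
  show "(\<Sum>i'\<le>n. \<Sum>j'\<le>m. A.R g i' i * B.R g j' j * T i' j' l) = (\<Sum>l'\<le>n + m. RD g l l' * T i j l')"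
    if g: "g \<in> SL2" for g i j l
  proof -
    have "(\<Sum>i'\<le>n. \<Sum>j'\<le>m. A.R g i' i * B.R g j' j * T i' j' l) = \<phi> (\<rho>A g (eA i)) (\<rho>B g (eB j)) (eC l)"
      by (subst \<phi>_AB) (simp only: A.R_def B.R_def)
    \<comment> \<open>Inserting \<open>g\<close> times its inverse in the third slot lets invariance
      strip \<open>g\<close> from all three arguments; the remaining inverse is the dual
      action.\<close>
    also have "\<dots> = \<phi> (\<rho>A g (eA i)) (\<rho>B g (eB j)) (\<rho>C g (\<rho>C (matrix_inv g) (eC l)))"
      using C.act_mult[of g "matrix_inv g" "eC l"] g by (simp add: matrix_inv_SL2 C.act_one)
    also have "\<dots> = dual_action \<rho>C g (\<phi> (eA i) (eB j)) (eC l)"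
      using g by (simp only: \<phi>_strictly_invariant dual_action_def)
    also have "\<dots> = (\<Sum>l'\<le>n + m. RD g l l' * T i j l')"
      by (rule dual_coordinates_act[OF g linear_\<phi>(3)])
    finally show ?thesis .
  qed
  show "\<exists>l\<le>n + m. (\<Sum>i\<le>n. \<Sum>j\<le>m. u i * v j * T i j l) \<noteq> 0"
    if u: "\<exists>i\<le>n. u i \<noteq> 0" and v: "\<exists>j\<le>m. v j \<noteq> 0" for u v
  proof -
    define a where "a = (\<Sum>i\<le>n. scaleA (u i) (eA i))"
    define b where "b = (\<Sum>j\<le>m. scaleB (v j) (eB j))"
    have xa: "xA i a = u i" if "i \<le> n" for i using that unfolding a_def by (rule A.x_sum)
    have xb: "xB j b = v j" if "j \<le> m" for j using that unfolding b_def by (rule B.x_sum)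
    have "a \<noteq> 0" using u xa A.x_scale[of _ 0 0] by force
    moreover have "b \<noteq> 0" using v xb B.x_scale[of _ 0 0] by force
    ultimately obtain c where "\<phi> a b c \<noteq> 0" using nonzero_value by blast
    then have "\<exists>l\<le>n + m. xC l c * \<phi> a b (eC l) \<noteq> 0"
      unfolding \<phi>_C[of a b c] by (metis (no_types, lifting) atMost_iff sum.neutral)
    then obtain l where l: "l \<le> n + m" "\<phi> a b (eC l) \<noteq> 0" by auto
    moreover have "\<phi> a b (eC l) = (\<Sum>i\<le>n. \<Sum>j\<le>m. u i * v j * T i j l)"
      unfolding \<phi>_AB[of a b] by (intro sum.cong) (auto simp: xa xb)
    ultimately show ?thesis by auto
  qed
qed

sublocale boundary_tensor n m wA wB "\<lambda>l. - wC l" A.R B.R RD T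
  by (rule boundary_tensor)

sublocale FA: irreducible_weight_rep n wA A.R by (rule irreducible)
sublocale FB: irreducible_weight_rep m wB B.R by (rule irreducible)
sublocale FD: irreducible_weight_rep "n + m" "\<lambda>l. - wC l" RD by (rule irreducible)

lemma is_multiplication: "is_multiplication n m scaleA \<rho>A scaleB \<rho>B scaleC \<rho>C \<phi>"
  unfolding is_multiplication_def
proof (intro exI conjI allI)
  let ?\<alpha> = "\<lambda>a. FA.to_form (\<lambda>i. xA i a)"
  let ?\<beta> = "\<lambda>b. FB.to_form (\<lambda>j. xB j b)"
  \<comment> \<open>The coordinates of a functional in the dual basis are its values on the vectors
    \<open>eC l\<close>.\<close>
  let ?\<gamma> = "\<lambda>f. FD.to_form (\<lambda>l. f (eC l))"
  show "SL2_iso scaleA UNIV \<rho>A fun_scale (binary_forms n) forms_action ?\<alpha>"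
  proof (rule FA.SL2_iso_to_form)
    show "v = w" if "\<And>i. i \<le> n \<Longrightarrow> xA i v = xA i w" for v w using A.coordinates_inject that by blast
    show "\<exists>v\<in>UNIV. \<forall>i\<le>n. xA i v = c i" for c using A.x_sum[of _ c] by blast
  qed (simp_all only: A.x_add A.x_scale A.x_act)
  show "SL2_iso scaleB UNIV \<rho>B fun_scale (binary_forms m) forms_action ?\<beta>"
  proof (rule FB.SL2_iso_to_form)
    show "v = w" if "\<And>i. i \<le> m \<Longrightarrow> xB i v = xB i w" for v w using B.coordinates_inject that by blast
    show "\<exists>v\<in>UNIV. \<forall>i\<le>m. xB i v = c i" for c using B.x_sum[of _ c] by blast
  qed (simp_all only: B.x_add B.x_scale B.x_act)
  show "SL2_iso fun_scale (dual_space scaleC) (dual_action \<rho>C) fun_scale (binary_forms (n + m)) forms_action ?\<gamma>"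
  proof (rule FD.SL2_iso_to_form)
    show "f = h" if "f \<in> dual_space scaleC" "h \<in> dual_space scaleC" "\<And>i. i \<le> n + m \<Longrightarrow> f (eC i) = h (eC i)" for f h
    proof
      fix v
      show "f v = h v"
        using that C.functional_expand[of f v] C.functional_expand[of h v] by (simp add: dual_space_def)
    qed
    show "\<exists>f\<in>dual_space scaleC. \<forall>i\<le>n + m. f (eC i) = c i" for c
    proof (intro bexI allI impI)
      let ?f = "\<lambda>v. \<Sum>l\<le>n + m. xC l v * c l"
      show "?f (eC i) = c i" if "i \<le> n + m" for i
      proof -
        have "?f (eC i) = (\<Sum>l\<le>n + m. if l = i then c i else 0)"
          using that by (intro sum.cong) (auto simp: C.x_e)
        then show ?thesis using that by simp
      qed
      have "vector_space scaleC" "vector_space ((*) :: complex \<Rightarrow> complex \<Rightarrow> complex)"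
        using C.x_linear unfolding Vector_Spaces.linear_iff by blast+
      then show "?f \<in> dual_space scaleC"
        by (simp add: dual_space_def Vector_Spaces.linear_iff C.x_add C.x_scale distrib_right sum.distrib
            sum_distrib_left mult.assoc)
    qed
    show "dual_action \<rho>C g f (eC i) = (\<Sum>j\<le>n + m. RD g i j * f (eC j))"
      if "g \<in> SL2" "f \<in> dual_space scaleC" for g f i
      using that by (intro dual_coordinates_act) (auto simp: dual_space_def)
  qed (simp_all add: fun_scale_def)
  show "T 0 0 0 \<noteq> 0" using T_nonzero[of 0 0] by simp
  show "?\<gamma> (\<phi> a b) = fun_scale (T 0 0 0) (?\<alpha> a * ?\<beta> b)" for a b
  proof
    fix w
    show "?\<gamma> (\<phi> a b) w = fun_scale (T 0 0 0) (?\<alpha> a * ?\<beta> b) w"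
    proof (cases "w = 0")
      case True
      then show ?thesis by (simp add: fun_scale_def FA.to_form_0 FD.to_form_0)
    next
      case False
      \<comment> \<open>At the first row of \<open>h\<close> each form is coordinate
        \<open>0\<close> of the translate by \<open>h\<close>, so \<open>first_row_mult\<close>
        applies to each pair of basis vectors.\<close>
      then obtain h where h: "h \<in> SL2" "h $ 1 = w" by (rule SL2_first_row)
      have "?\<gamma> (\<phi> a b) w = (\<Sum>l\<le>n + m. RD h 0 l * \<phi> a b (eC l))"
        using FD.to_form_row[OF h(1)] h(2) by blast
      also have "\<dots> = (\<Sum>l\<le>n + m. \<Sum>i\<le>n. \<Sum>j\<le>m. xA i a * xB j b * (RD h 0 l * T i j l))"
        by (subst \<phi>_AB) (simp add: sum_distrib_left mult_ac)
      also have "\<dots> = (\<Sum>i\<le>n. \<Sum>l\<le>n + m. \<Sum>j\<le>m. xA i a * xB j b * (RD h 0 l * T i j l))"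
        by (rule sum.swap)
      also have "\<dots> = (\<Sum>i\<le>n. \<Sum>j\<le>m. \<Sum>l\<le>n + m. xA i a * xB j b * (RD h 0 l * T i j l))"
        by (intro sum.cong refl sum.swap)
      also have "\<dots> = (\<Sum>i\<le>n. \<Sum>j\<le>m. xA i a * xB j b * (T 0 0 0 * (A.R h 0 i * B.R h 0 j)))"
        using first_row_mult[OF h(1)] by (intro sum.cong) (auto simp flip: sum_distrib_left)
      also have "\<dots> = T 0 0 0 * ((\<Sum>i\<le>n. A.R h 0 i * xA i a) * (\<Sum>j\<le>m. B.R h 0 j * xB j b))"
        by (simp only: sum_product) (simp add: sum_distrib_left mult_ac)
      also have "\<dots> = T 0 0 0 * (?\<alpha> a w * ?\<beta> b w)"
        using FA.to_form_row[OF h(1), of "\<lambda>i. xA i a"] FB.to_form_row[OF h(1), of "\<lambda>j. xB j b"] h(2) by simp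
      finally show ?thesis by (simp add: fun_scale_def)
    qed
  qed
qed

end

section \<open>The converse direction and the equivalence\<close>

lemma SL2_iso_zero:
  assumes "SL2_iso scaleV UNIV \<rho> scaleW W \<sigma> T" "T v = 0"
  shows "v = 0"
proof -
  have "T (0 + 0) = T 0 + T 0" "inj T"
    using assms(1) unfolding SL2_iso_def bij_betw_def by blast+
  then show ?thesis using assms(2) injD[of T v 0] by simp
qed

text \<open>Tangency includes \<open>\<phi> a b = 0\<close>, which would make a product of two
  nonzero forms vanish.\<close>

lemma multiplication_Det_nonzero:
  assumes hyperplane: "hyperplane_form scaleA scaleB scaleC \<phi>"
    and mult: "is_multiplication n m scaleA \<rho>A scaleB \<rho>B scaleC \<rho>C \<phi>"
  shows "Det_nonzero \<phi>"
  unfolding Det_nonzero_def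
proof (clarify)
  fix a b c
  assume nz: "a \<noteq> 0" "b \<noteq> 0" and "tangent_at \<phi> a b c"
  then have zero: "\<phi> a b = 0" by (simp add: tangent_at_def fun_eq_iff)
  obtain \<alpha> \<beta> \<gamma> k where
      \<alpha>: "SL2_iso scaleA UNIV \<rho>A fun_scale (binary_forms n) forms_action \<alpha>"
    and \<beta>: "SL2_iso scaleB UNIV \<rho>B fun_scale (binary_forms m) forms_action \<beta>"
    and \<gamma>: "SL2_iso fun_scale (dual_space scaleC) (dual_action \<rho>C) fun_scale (binary_forms (n + m)) forms_action \<gamma>"
    and k: "k \<noteq> 0" and \<phi>: "\<And>a b. \<gamma> (\<phi> a b) = fun_scale k (\<alpha> a * \<beta> b)"
    using mult unfolding is_multiplication_def by blast
  have "\<phi> a b \<in> dual_space scaleC" using hyperplane by (simp add: hyperplane_form_def dual_space_def)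
  then have "\<gamma> (\<phi> a b + \<phi> a b) = \<gamma> (\<phi> a b) + \<gamma> (\<phi> a b)" using \<gamma> unfolding SL2_iso_def by blast
  then have "\<gamma> (\<phi> a b) = 0" unfolding zero by simp
  then have "\<alpha> a * \<beta> b = 0" using k by (simp add: \<phi> fun_scale_def fun_eq_iff)
  moreover have "\<alpha> a \<in> binary_forms n" "\<beta> b \<in> binary_forms m"
    using \<alpha> \<beta> unfolding SL2_iso_def bij_betw_def by blast+
  ultimately have "\<alpha> a = 0 \<or> \<beta> b = 0" using binary_forms_no_zero_divisors by blast
  then show False using SL2_iso_zero[OF \<alpha>] SL2_iso_zero[OF \<beta>] nz by blast
qed

theorem theorem2p1:
  fixes scaleA :: "complex \<Rightarrow> 'a::ab_group_add \<Rightarrow> 'a"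
    and scaleB :: "complex \<Rightarrow> 'b::ab_group_add \<Rightarrow> 'b"
    and scaleC :: "complex \<Rightarrow> 'c::ab_group_add \<Rightarrow> 'c"
    and \<rho>A :: "complex^2^2 \<Rightarrow> 'a \<Rightarrow> 'a"
    and \<rho>B :: "complex^2^2 \<Rightarrow> 'b \<Rightarrow> 'b"
    and \<rho>C :: "complex^2^2 \<Rightarrow> 'c \<Rightarrow> 'c"
    and \<phi> :: "'a \<Rightarrow> 'b \<Rightarrow> 'c \<Rightarrow> complex"
    and n m :: nat
  assumes "SL2_module scaleA UNIV \<rho>A" and "nontrivial_action UNIV \<rho>A"
    and "SL2_module scaleB UNIV \<rho>B" and "nontrivial_action UNIV \<rho>B"
    and "SL2_module scaleC UNIV \<rho>C" and "nontrivial_action UNIV \<rho>C"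
    and "vector_space.dim scaleA UNIV = n + 1"
    and "vector_space.dim scaleB UNIV = m + 1"
    and "vector_space.dim scaleC UNIV = n + m + 1"
    and "hyperplane_form scaleA scaleB scaleC \<phi>"
    and "hyperplane_invariant \<rho>A \<rho>B \<rho>C \<phi>"
  shows "Det_nonzero \<phi> \<longleftrightarrow>
         is_multiplication n m scaleA \<rho>A scaleB \<rho>B scaleC \<rho>C \<phi>"
proof
  assume Det: "Det_nonzero \<phi>"
  obtain eA xA wA where A: "weight_basis scaleA \<rho>A n eA xA wA" "\<And>i j. i \<le> j \<Longrightarrow> j \<le> n \<Longrightarrow> wA j \<le> wA i"
    using exists_weight_basis[OF assms(1,7)] by blast
  obtain eB xB wB where B: "weight_basis scaleB \<rho>B m eB xB wB" "\<And>i j. i \<le> j \<Longrightarrow> j \<le> m \<Longrightarrow> wB j \<le> wB i"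
    using exists_weight_basis[OF assms(3,8)] by blast
  obtain eC xC wC where C: "weight_basis scaleC \<rho>C (n + m) eC xC wC"
      "\<And>i j. i \<le> j \<Longrightarrow> j \<le> n + m \<Longrightarrow> wC j \<le> wC i"
    using exists_weight_basis[OF assms(5,9)] by blast
  \<comment> \<open>The basis of \<open>C\<close> is reversed, as its weights must increase
    here.\<close>
  have "weight_trilinear scaleA \<rho>A n eA xA wA scaleB \<rho>B m eB xB wB scaleC \<rho>C
      (\<lambda>i. eC (n + m - i)) (\<lambda>i. xC (n + m - i)) (\<lambda>i. wC (n + m - i)) \<phi>"
    by (intro weight_trilinear.intro weight_trilinear_axioms.intro A B weight_basis.reverse[OF C(1)]
        Det assms(2,4,10,11) C(2)) auto
  then show "is_multiplication n m scaleA \<rho>A scaleB \<rho>B scaleC \<rho>C \<phi>"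
    by (rule weight_trilinear.is_multiplication)
next
  assume "is_multiplication n m scaleA \<rho>A scaleB \<rho>B scaleC \<rho>C \<phi>"
  then show "Det_nonzero \<phi>" by (rule multiplication_Det_nonzero[OF assms(10)])
qed

end
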